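(* Let $p>1$ and let $\psi:[0,1]\to\mathbb{R}$ be continuous with $\psi(0)<0$, $\psi(1)<0$, and $\psi(x_0)>0$ for some $x_0\in(0,1)$. Suppose that $$\inf_{v\in M_{\rm sym}(\psi)}\mathcal{E}_p(v)<c_p^p,\qquad c_p:=2\int_0^\infty\frac{dt}{(1+t^2)^{\frac32-\frac1{2p}}}.$$ Then there exists a minimizer $u\in M_{\rm sym}(\psi)$ of $\mathcal{E}_p$ in $M_{\rm sym}(\psi)$.
   Context: $\mathcal{E}_p(u):=\int_0^1|\kappa_u|^p\sqrt{1+(u')^2}\,dx$ with $\kappa_u=u''/(1+(u')^2)^{3/2}$. $M(\psi) := \{ v \in W^{2,p}(0,1)\cap W^{1,p}_0(0,1) : v \ge \psi \text{ on } [0,1]\}$ and $M_{\rm sym}(\psi) := \{ v\in M(\psi) : v(x)=v(1-x) \text{ for } x\in[0,1]\}$. *)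

theory Defs
  imports "HOL-Analysis.Analysis"
begin

text \<open>W^{2,p}(0,1), identified with continuous representatives: u is C^1 on [0,1],
  and u' = a + (integral of w) for some w in L^p(0,1) (i.e. u' absolutely continuous
  with second derivative w in L^p).\<close>
definition W2p :: "real \<Rightarrow> (real \<Rightarrow> real) \<Rightarrow> bool" where
  "W2p p u \<longleftrightarrow> (\<exists>a w.
      set_integrable lebesgue {0..1} w \<and>
      set_integrable lebesgue {0..1} (\<lambda>x. \<bar>w x\<bar> powr p) \<and>
      (\<forall>x\<in>{0..1}. (u has_real_derivative (a + (LINT t:{0..x}|lebesgue. w t))) (at x within {0..1})))"

definition W2p_W1p0 :: "real \<Rightarrow> (real \<Rightarrow> real) \<Rightarrow> bool" where
  "W2p_W1p0 p u \<longleftrightarrow> W2p p u \<and> u 0 = 0 \<and> u 1 = 0"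

definition curv :: "(real \<Rightarrow> real) \<Rightarrow> real \<Rightarrow> real" where
  "curv u x = deriv (deriv u) x / (1 + (deriv u x)\<^sup>2) powr (3/2)"

definition Ep :: "real \<Rightarrow> (real \<Rightarrow> real) \<Rightarrow> real" where
  "Ep p u = (LINT x:{0..1}|lebesgue. \<bar>curv u x\<bar> powr p * sqrt (1 + (deriv u x)\<^sup>2))"

definition Mset :: "real \<Rightarrow> (real \<Rightarrow> real) \<Rightarrow> (real \<Rightarrow> real) set" where
  "Mset p \<psi> = {v. W2p_W1p0 p v \<and> (\<forall>x\<in>{0..1}. v x \<ge> \<psi> x)}"

definition Msym :: "real \<Rightarrow> (real \<Rightarrow> real) \<Rightarrow> (real \<Rightarrow> real) set" where
  "Msym p \<psi> = {v \<in> Mset p \<psi>. \<forall>x\<in>{0..1}. v x = v (1 - x)}"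

definition cp :: "real \<Rightarrow> real" where
  "cp p = 2 * (LINT t:{0..}|lborel. 1 / (1 + t\<^sup>2) powr (3/2 - 1 / (2 * p)))"

end

theory Submission
  imports Defs "HOL-Complex_Analysis.Great_Picard" "HOL-Probability.Sinc_Integral"
begin

text \<open>Let \<open>G\<close> be the odd primitive of the function sending \<open>s\<close> to \<open>1 + s\<^sup>2\<close> to the power
  \<open>1/(2p) - 3/2\<close>.  Its range is the interval from \<open>- c\<^sub>p / 2\<close> to \<open>c\<^sub>p / 2\<close>, and the energy of \<open>u\<close> is the
  \<open>p\<close>-th power of the \<open>L\<^sup>p\<close> norm of the derivative of \<open>z = G \<circ> u'\<close>.  For symmetric \<open>u\<close> the function
  \<open>z\<close> is odd about \<open>1/2\<close>, so by Hoelder's inequality \<open>2 |z|\<close> is at most the \<open>p\<close>-th root of the energy.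
  An energy level below \<open>c\<^sub>p\<close> to the power \<open>p\<close> therefore keeps \<open>z\<close> in a compact part of the range of \<open>G\<close>
  along a minimising sequence.  By Arzela--Ascoli and the strict convexity of the energy in \<open>z'\<close>, a
  subsequence of \<open>z\<close> converges uniformly to some \<open>Z\<close> of no larger energy, and the antiderivative of
  the inverse of \<open>G\<close> composed with \<open>Z\<close> is a minimiser.\<close>

section \<open>Spaces of \<open>p\<close>-integrable functions\<close>

definition Lp :: "real \<Rightarrow> 'a measure \<Rightarrow> ('a \<Rightarrow> real) set" where
  "Lp p M = {f \<in> borel_measurable M. integrable M (\<lambda>x. \<bar>f x\<bar> powr p)}"

definition Lp_energy :: "real \<Rightarrow> 'a measure \<Rightarrow> ('a \<Rightarrow> real) \<Rightarrow> real" where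
  "Lp_energy p M f = (\<integral>x. \<bar>f x\<bar> powr p \<partial>M)"

lemma Lp_measurable [measurable_dest]: "f \<in> Lp p M \<Longrightarrow> f \<in> borel_measurable M"
  by (simp add: Lp_def)

lemma Lp_integrable_powr: "f \<in> Lp p M \<Longrightarrow> integrable M (\<lambda>x. \<bar>f x\<bar> powr p)"
  by (simp add: Lp_def)

lemma Lp_energy_nonneg: "Lp_energy p M f \<ge> 0"
  by (simp add: Lp_energy_def)

lemma Lp_1_iff_integrable: "f \<in> Lp 1 M \<longleftrightarrow> integrable M f"
  by (auto simp: Lp_def integrable_abs_iff)

lemma (in finite_measure) Lp_integrable:
  assumes "p \<ge> 1" "f \<in> Lp p M"
  shows "integrable M f"
proof (rule Bochner_Integration.integrable_bound)
  show "integrable M (\<lambda>x. 1 + \<bar>f x\<bar> powr p)"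
    using Lp_integrable_powr[OF assms(2)] by simp
  have "t \<le> 1 + t powr p" if "t \<ge> 0" for t :: real
  proof (cases "t \<le> 1")
    case False
    then show ?thesis
      using powr_mono[of 1 p t] assms(1) by simp
  qed (simp add: add_increasing2)
  then show "AE x in M. norm (f x) \<le> norm (1 + \<bar>f x\<bar> powr p)"
    by (intro AE_I2) simp
qed (use assms(2) in measurable)

lemma Lp_mult_bounded:
  assumes f: "f \<in> Lp p M" and p: "p \<ge> 0"
    and g: "g \<in> borel_measurable M" "\<And>x. x \<in> space M \<Longrightarrow> \<bar>g x\<bar> \<le> C"
  shows "(\<lambda>x. g x * f x) \<in> Lp p M"
proof -
  have "integrable M (\<lambda>x. \<bar>g x * f x\<bar> powr p)"
  proof (rule Bochner_Integration.integrable_bound)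
    show "integrable M (\<lambda>x. C powr p * \<bar>f x\<bar> powr p)"
      using Lp_integrable_powr[OF f] by simp
    show "(\<lambda>x. \<bar>g x * f x\<bar> powr p) \<in> borel_measurable M"
      using f g(1) by measurable
    show "AE x in M. norm (\<bar>g x * f x\<bar> powr p) \<le> norm (C powr p * \<bar>f x\<bar> powr p)"
      using g(2) p by (intro AE_I2) (auto simp: abs_mult powr_mult intro!: mult_right_mono powr_mono2)
  qed
  then show ?thesis
    using f g(1) by (auto simp: Lp_def)
qed

lemma Lp_Fatou:
  fixes f :: "nat \<Rightarrow> 'a \<Rightarrow> real"
  assumes p: "p > 0" and f: "\<And>n. f n \<in> Lp p M" and g [measurable]: "g \<in> borel_measurable M"
    and lim: "AE x in M. (\<lambda>n. f n x) \<longlonglongrightarrow> g x"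
    and E: "\<And>n. Lp_energy p M (f n) \<le> E n" and E_lim: "E \<longlonglongrightarrow> L"
  shows "g \<in> Lp p M" and "Lp_energy p M g \<le> L"
proof -
  note [measurable] = Lp_measurable[OF f]
  have L: "L \<ge> 0"
    using order_trans[OF Lp_energy_nonneg E] by (intro LIMSEQ_le_const[OF E_lim]) auto
  have "(\<integral>\<^sup>+x. ennreal (\<bar>g x\<bar> powr p) \<partial>M) = (\<integral>\<^sup>+x. liminf (\<lambda>n. ennreal (\<bar>f n x\<bar> powr p)) \<partial>M)"
  proof (rule nn_integral_cong_AE)
    show "AE x in M. ennreal (\<bar>g x\<bar> powr p) = liminf (\<lambda>n. ennreal (\<bar>f n x\<bar> powr p))"
      using lim
    proof eventually_elim
      case (elim x)
      then have "(\<lambda>n. ennreal (\<bar>f n x\<bar> powr p)) \<longlonglongrightarrow> ennreal (\<bar>g x\<bar> powr p)"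
        using p by (intro tendsto_ennrealI tendsto_powr' tendsto_rabs) auto
      then show ?case
        by (simp only: lim_imp_Liminf[OF sequentially_bot])
    qed
  qed
  also have "\<dots> \<le> liminf (\<lambda>n. \<integral>\<^sup>+x. ennreal (\<bar>f n x\<bar> powr p) \<partial>M)"
    by (intro nn_integral_liminf) measurable
  also have "\<dots> \<le> liminf (\<lambda>n. ennreal (E n))"
    using E Lp_integrable_powr[OF f] unfolding Lp_energy_def
    by (intro Liminf_mono always_eventually allI) (simp add: nn_integral_eq_integral ennreal_leI)
  also have "\<dots> = ennreal L"
    using E_lim by (intro lim_imp_Liminf tendsto_ennrealI) auto
  finally have le: "(\<integral>\<^sup>+x. ennreal (\<bar>g x\<bar> powr p) \<partial>M) \<le> ennreal L" .
  have int: "integrable M (\<lambda>x. \<bar>g x\<bar> powr p)"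
    by (rule integrableI_nonneg) (use le in \<open>auto simp: less_top[symmetric] top_unique\<close>)
  then show "g \<in> Lp p M"
    by (simp add: Lp_def)
  show "Lp_energy p M g \<le> L"
    using le L by (simp add: Lp_energy_def nn_integral_eq_integral[OF int])
qed

lemma L1_dist_le_AE_limit:
  fixes f :: "nat \<Rightarrow> 'a \<Rightarrow> real"
  assumes h: "integrable M h" and f: "\<And>n. integrable M (f n)" and g: "g \<in> borel_measurable M"
    and lim: "AE x in M. (\<lambda>n. f n x) \<longlonglongrightarrow> g x" and dist: "\<And>n. (\<integral>x. \<bar>h x - f n x\<bar> \<partial>M) \<le> C"
  shows "(\<integral>x. \<bar>h x - g x\<bar> \<partial>M) \<le> C"
proof -
  have "Lp_energy 1 M (\<lambda>x. h x - g x) \<le> C"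
  proof (rule Lp_Fatou(2)[where f = "\<lambda>n x. h x - f n x"])
    show "(\<lambda>x. h x - f n x) \<in> Lp 1 M" for n
      using h f by (simp add: Lp_1_iff_integrable)
    show "(\<lambda>x. h x - g x) \<in> borel_measurable M"
      using h g by auto
    show "AE x in M. (\<lambda>n. h x - f n x) \<longlonglongrightarrow> h x - g x"
      using lim by eventually_elim (intro tendsto_intros)
    show "Lp_energy 1 M (\<lambda>x. h x - f n x) \<le> C" for n
      using dist by (simp add: Lp_energy_def)
  qed auto
  then show ?thesis
    by (simp add: Lp_energy_def)
qed

lemma L1_Cauchy_AE_convergent_subseq:
  fixes f :: "nat \<Rightarrow> 'a \<Rightarrow> real"
  assumes f: "\<And>n. integrable M (f n)"
    and Cauchy: "\<And>e. e > 0 \<Longrightarrow> \<exists>N. \<forall>i\<ge>N. \<forall>j\<ge>N. (\<integral>x. \<bar>f i x - f j x\<bar> \<partial>M) < e"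
  obtains g r where "g \<in> borel_measurable M" "strict_mono r" "AE x in M. (\<lambda>i. f (r i) x) \<longlonglongrightarrow> g x"
    "(\<lambda>n. \<integral>x. \<bar>f n x - g x\<bar> \<partial>M) \<longlonglongrightarrow> 0"
proof -
  obtain r where r: "strict_mono r" "AE x in M. Cauchy (\<lambda>i. f (r i) x)"
    using cauchy_L1_AE_cauchy_subseq[of M f, unfolded real_norm_def, OF f Cauchy] by blast
  define g where "g x = lim (\<lambda>i. f (r i) x)" for x
  have [measurable]: "f n \<in> borel_measurable M" for n
    using f by auto
  have g: "g \<in> borel_measurable M"
    unfolding g_def by measurable
  have lim: "AE x in M. (\<lambda>i. f (r i) x) \<longlonglongrightarrow> g x"
    using r(2) by eventually_elim (simp add: g_def Cauchy_convergent_iff convergent_LIMSEQ_iff)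
  have "(\<lambda>n. \<integral>x. \<bar>f n x - g x\<bar> \<partial>M) \<longlonglongrightarrow> 0"
  proof (rule LIMSEQ_I)
    fix e :: real assume "e > 0"
    then obtain N where N: "\<And>i j. i \<ge> N \<Longrightarrow> j \<ge> N \<Longrightarrow> (\<integral>x. \<bar>f i x - f j x\<bar> \<partial>M) < e / 2"
      using Cauchy[of "e / 2"] by auto
    have "(\<integral>x. \<bar>f n x - g x\<bar> \<partial>M) \<le> e / 2" if n: "n \<ge> N" for n
    proof (rule L1_dist_le_AE_limit[where f = "\<lambda>i. f (r (i + N))", OF f f g])
      show "AE x in M. (\<lambda>i. f (r (i + N)) x) \<longlonglongrightarrow> g x"
        using lim by eventually_elim (rule LIMSEQ_ignore_initial_segment)
      show "(\<integral>x. \<bar>f n x - f (r (i + N)) x\<bar> \<partial>M) \<le> e / 2" for i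
        using N[of n "r (i + N)"] n seq_suble[OF r(1), of "i + N"] by simp
    qed
    then show "\<exists>N. \<forall>n\<ge>N. norm ((\<integral>x. \<bar>f n x - g x\<bar> \<partial>M) - 0) < e"
      using \<open>e > 0\<close> by (fastforce intro!: exI[of _ N])
  qed
  with that g r(1) lim show thesis
    by blast
qed

section \<open>Strict convexity of the \<open>p\<close>-energy\<close>

lemma strict_mono_deriv_above_tangent:
  fixes f f' :: "real \<Rightarrow> real"
  assumes f: "\<And>x. x > c \<Longrightarrow> (f has_real_derivative f' x) (at x)"
    and f': "strict_mono_on {c<..} f'" and "x > c" "y > c" "x \<noteq> y"
  shows "f x + f' x * (y - x) < f y"
proof (cases "x < y")
  case True
  then obtain z where z: "x < z" "z < y" "f y - f x = (y - x) * f' z"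
    using MVT2[of x y f f'] f \<open>x > c\<close> by auto
  then have "(y - x) * f' x < (y - x) * f' z"
    using f' \<open>x > c\<close> by (auto simp: strict_mono_on_def)
  then show ?thesis
    using z(3) by (simp add: algebra_simps)
next
  case False
  then obtain z where z: "y < z" "z < x" "f x - f y = (x - y) * f' z"
    using MVT2[of y x f f'] f \<open>y > c\<close> \<open>x \<noteq> y\<close> by auto
  then have "(x - y) * f' z < (x - y) * f' x"
    using f' \<open>y > c\<close> by (auto simp: strict_mono_on_def)
  then show ?thesis
    using z(3) by (simp add: algebra_simps)
qed

lemma powr_above_tangent:
  fixes p t m :: real
  assumes "p > 1" "t \<ge> 0" "m > 0"
  shows "m powr p + p * m powr (p - 1) * (t - m) \<le> t powr p"
    and "t \<noteq> m \<Longrightarrow> m powr p + p * m powr (p - 1) * (t - m) < t powr p"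
proof -
  show strict: "m powr p + p * m powr (p - 1) * (t - m) < t powr p" if "t \<noteq> m"
  proof (cases "t = 0")
    case True
    have "m powr (p - 1) * m = m powr p" and "m powr p < p * m powr p"
      using assms by (simp_all add: powr_mult_base' powr_diff)
    with True show ?thesis
      by (simp add: algebra_simps)
  next
    case False
    show ?thesis
    proof (rule strict_mono_deriv_above_tangent[where c = 0 and f = "\<lambda>s. s powr p"])
      show "((\<lambda>s. s powr p) has_real_derivative p * s powr (p - 1)) (at s)" if "s > 0" for s
        using has_real_derivative_powr[OF that] by simp
      show "strict_mono_on {0<..} (\<lambda>s. p * s powr (p - 1))"
        using assms by (auto simp: strict_mono_on_def intro: powr_less_mono2)
    qed (use assms False that in auto)
  qed
  show "m powr p + p * m powr (p - 1) * (t - m) \<le> t powr p"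
    using strict by (cases "t = m") auto
qed

lemma (in finite_measure) integral_abs_le_Lp_energy:
  assumes p: "p > 1" and f: "f \<in> Lp p M"
  shows "(\<integral>x. \<bar>f x\<bar> \<partial>M) \<le> measure M (space M) powr (1 - 1 / p) * Lp_energy p M f powr (1 / p)"
proof (cases "(\<integral>x. \<bar>f x\<bar> \<partial>M) = 0")
  case False
  define \<mu> I where "\<mu> = measure M (space M)" and "I = (\<integral>x. \<bar>f x\<bar> \<partial>M)"
  have int: "integrable M (\<lambda>x. \<bar>f x\<bar>)"
    using Lp_integrable[OF _ f] p by simp
  have I: "I > 0"
    using False by (simp add: I_def less_le)
  have "\<mu> \<noteq> 0"
  proof
    assume "\<mu> = 0"
    then have "AE x in M. x \<notin> space M"
      by (intro AE_not_in) (auto simp: \<mu>_def emeasure_eq_measure null_sets_def)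
    then have "I = (\<integral>x. 0 \<partial>M)"
      unfolding I_def by (intro integral_cong_AE) (use int AE_space in \<open>auto elim: eventually_elim2\<close>)
    with I show False by simp
  qed
  then have \<mu>: "\<mu> > 0"
    by (simp add: \<mu>_def less_le)
  define m where "m = I / \<mu>"
  have m: "m > 0"
    using I \<mu> by (simp add: m_def)
  have "\<mu> * m powr p = (\<integral>x. m powr p + p * m powr (p - 1) * (\<bar>f x\<bar> - m) \<partial>M)"
    using int \<mu> by (simp add: m_def I_def \<mu>_def right_diff_distrib)
  also have "\<dots> \<le> Lp_energy p M f"
    unfolding Lp_energy_def using int Lp_integrable_powr[OF f] powr_above_tangent(1)[OF p _ m]
    by (intro integral_mono) auto
  finally have "(\<mu> * m powr p) powr (1 / p) \<le> Lp_energy p M f powr (1 / p)"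
    using p \<mu> by (intro powr_mono2) auto
  then have "\<mu> powr (1 - 1 / p) * (\<mu> powr (1 / p) * m) \<le>
      \<mu> powr (1 - 1 / p) * Lp_energy p M f powr (1 / p)"
    using p m \<mu> by (intro mult_left_mono) (auto simp: powr_mult powr_powr)
  also have "\<mu> powr (1 - 1 / p) * (\<mu> powr (1 / p) * m) = I"
    using \<mu> by (simp add: m_def powr_diff)
  finally show ?thesis
    by (simp add: \<mu>_def I_def)
qed (simp add: Lp_energy_nonneg)

definition powr_gap :: "real \<Rightarrow> real \<Rightarrow> real \<Rightarrow> real" where
  "powr_gap p a b = (\<bar>a\<bar> powr p + \<bar>b\<bar> powr p) / 2 - \<bar>(a + b) / 2\<bar> powr p"

lemma powr_gap_pos:
  assumes p: "p > 1" and "a \<noteq> b"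
  shows "powr_gap p a b > 0"
proof (cases "a + b = 0")
  case True
  then have "\<bar>a\<bar> powr p + \<bar>b\<bar> powr p > 0"
    using assms by (intro add_pos_pos) auto
  then show ?thesis
    using True by (simp add: powr_gap_def)
next
  case False
  define m q where "m = \<bar>(a + b) / 2\<bar>" and "q = p * m powr (p - 1)"
  have m: "m > 0" and q: "q > 0"
    using False p by (simp_all add: m_def q_def)
  note tangent = powr_above_tangent[OF p abs_ge_zero m, folded q_def]
  have "\<bar>a\<bar> \<noteq> m \<or> \<bar>b\<bar> \<noteq> m"
    using \<open>a \<noteq> b\<close> by (auto simp: m_def abs_if split: if_splits)
  then have "m powr p + q * (\<bar>a\<bar> - m) + (m powr p + q * (\<bar>b\<bar> - m)) < \<bar>a\<bar> powr p + \<bar>b\<bar> powr p"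
    using tangent[of a] tangent[of b] by linarith
  moreover have "q * (\<bar>a\<bar> + \<bar>b\<bar> - 2 * m) \<ge> 0"
    using q by (simp add: m_def)
  ultimately have "2 * m powr p < \<bar>a\<bar> powr p + \<bar>b\<bar> powr p"
    by (simp add: algebra_simps)
  then show ?thesis
    by (simp add: powr_gap_def m_def)
qed

lemma powr_gap_nonneg: "p > 1 \<Longrightarrow> powr_gap p a b \<ge> 0"
  using powr_gap_pos[of p a b] by (cases "a = b") (auto simp: powr_gap_def)

lemma powr_gap_ge_on_bounded:
  assumes p: "p > 1" and e: "e > 0"
  obtains g where "g > 0"
    "\<And>a b. \<bar>a\<bar> \<le> R \<Longrightarrow> \<bar>b\<bar> \<le> R \<Longrightarrow> e \<le> \<bar>a - b\<bar> \<Longrightarrow> g \<le> powr_gap p a b"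
proof -
  define S where "S = ({-R..R} \<times> {-R..R}) \<inter> {z. e \<le> \<bar>fst z - snd z\<bar>}"
  have S_iff: "(a, b) \<in> S \<longleftrightarrow> \<bar>a\<bar> \<le> R \<and> \<bar>b\<bar> \<le> R \<and> e \<le> \<bar>a - b\<bar>" for a b
    by (auto simp: S_def)
  show thesis
  proof (cases "S = {}")
    case True
    then show thesis
      using that[of 1] S_iff by auto
  next
    case False
    have "compact S"
      unfolding S_def
      by (intro compact_Int_closed compact_Times compact_Icc closed_Collect_le continuous_intros)
    moreover have "continuous_on S (\<lambda>z. powr_gap p (fst z) (snd z))"
      unfolding powr_gap_def using p by (intro continuous_intros continuous_on_powr') auto
    ultimately obtain a b where ab: "(a, b) \<in> S" and
      min: "\<And>x y. (x, y) \<in> S \<Longrightarrow> powr_gap p a b \<le> powr_gap p x y"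
      using continuous_attains_inf[OF _ False, of "\<lambda>z. powr_gap p (fst z) (snd z)"] by fastforce
    show thesis
    proof (rule that)
      show "powr_gap p a b > 0"
        using ab e p by (intro powr_gap_pos) (auto simp: S_iff)
    qed (use min S_iff in blast)
  qed
qed

lemma abs_le_if_powr_le_diff:
  fixes a b e :: real
  assumes p: "p > 1" and e: "e > 0" and ab: "e * (\<bar>a\<bar> powr p + \<bar>b\<bar> powr p) \<le> \<bar>a - b\<bar>"
  shows "\<bar>a\<bar> \<le> (2 / e) powr (1 / (p - 1))"
proof -
  define M where "M = max \<bar>a\<bar> \<bar>b\<bar>"
  have "M \<le> (2 / e) powr (1 / (p - 1))"
  proof (cases "M = 0")
    case False
    then have M: "M > 0"
      by (auto simp: M_def)
    have "e * M powr p \<le> e * (\<bar>a\<bar> powr p + \<bar>b\<bar> powr p)"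
      using e by (intro mult_left_mono) (auto simp: M_def max_def)
    also have "\<dots> \<le> 2 * M"
      using ab by (auto simp: M_def)
    finally have "M powr (p - 1) \<le> 2 / e"
      using M e by (simp add: powr_diff field_simps)
    then have "(M powr (p - 1)) powr (1 / (p - 1)) \<le> (2 / e) powr (1 / (p - 1))"
      using p by (intro powr_mono2) auto
    then show ?thesis
      using p M by (simp add: powr_powr)
  qed simp
  then show ?thesis
    by (simp add: M_def)
qed

text \<open>As \<open>p > 1\<close>, the first term absorbs large values; the remaining pairs at distance at least \<open>e\<close>
  form a compact set, on which the gap is bounded below.\<close>

lemma abs_diff_le_powr_gap:
  fixes p e :: real
  assumes p: "p > 1" and e: "e > 0"
  obtains C where "C \<ge> 0"
    "\<And>a b. \<bar>a - b\<bar> \<le> e * (1 + \<bar>a\<bar> powr p + \<bar>b\<bar> powr p) + C * powr_gap p a b"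
proof -
  define R where "R = (2 / e) powr (1 / (p - 1))"
  obtain g where g: "g > 0"
    "\<And>a b. \<bar>a\<bar> \<le> R \<Longrightarrow> \<bar>b\<bar> \<le> R \<Longrightarrow> e \<le> \<bar>a - b\<bar> \<Longrightarrow> g \<le> powr_gap p a b"
    using powr_gap_ge_on_bounded[OF p e] by blast
  show thesis
  proof (rule that[of "2 * R / g"])
    show "2 * R / g \<ge> 0"
      using g(1) by (simp add: R_def)
    fix a b :: real
    have gap: "2 * R / g * powr_gap p a b \<ge> 0"
      using g(1) powr_gap_nonneg[OF p, of a b] by (simp add: R_def)
    show "\<bar>a - b\<bar> \<le> e * (1 + \<bar>a\<bar> powr p + \<bar>b\<bar> powr p) + 2 * R / g * powr_gap p a b"
    proof (cases "e * (1 + \<bar>a\<bar> powr p + \<bar>b\<bar> powr p) < \<bar>a - b\<bar>")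
      case True
      then have far: "e + e * (\<bar>a\<bar> powr p + \<bar>b\<bar> powr p) < \<bar>a - b\<bar>"
        by (simp add: algebra_simps)
      moreover have "e * (\<bar>a\<bar> powr p + \<bar>b\<bar> powr p) \<ge> 0"
        using e by simp
      ultimately have "e \<le> \<bar>a - b\<bar>"
        by linarith
      moreover have "\<bar>a\<bar> \<le> R" "\<bar>b\<bar> \<le> R"
        using abs_le_if_powr_le_diff[OF p e, of a b] abs_le_if_powr_le_diff[OF p e, of b a] far e
        by (simp_all add: R_def add.commute abs_minus_commute)
      ultimately have "\<bar>a - b\<bar> \<le> 2 * R" and "g \<le> powr_gap p a b"
        using g(2) by auto
      then have "\<bar>a - b\<bar> \<le> 2 * R / g * g"
        using g(1) by simp
      also have "\<dots> \<le> 2 * R / g * powr_gap p a b"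
        using g(1) \<open>g \<le> powr_gap p a b\<close> by (intro mult_left_mono) (auto simp: R_def)
      finally show ?thesis
        using e by (simp add: add_increasing)
    qed (use gap in linarith)
  qed
qed

lemma Lp_midpoint:
  assumes p: "p > 1" and f: "f \<in> Lp p M" and g: "g \<in> Lp p M"
  shows "(\<lambda>x. (f x + g x) / 2) \<in> Lp p M"
proof -
  note [measurable] = Lp_measurable[OF f] Lp_measurable[OF g]
  have "integrable M (\<lambda>x. \<bar>(f x + g x) / 2\<bar> powr p)"
  proof (rule Bochner_Integration.integrable_bound)
    show "integrable M (\<lambda>x. (\<bar>f x\<bar> powr p + \<bar>g x\<bar> powr p) / 2)"
      using Lp_integrable_powr[OF f] Lp_integrable_powr[OF g] by simp
    show "AE x in M. norm (\<bar>(f x + g x) / 2\<bar> powr p) \<le> norm ((\<bar>f x\<bar> powr p + \<bar>g x\<bar> powr p) / 2)"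
      using powr_gap_nonneg[OF p] by (intro AE_I2) (auto simp: powr_gap_def)
  qed measurable
  then show ?thesis
    by (simp add: Lp_def)
qed

lemma integral_powr_gap:
  assumes p: "p > 1" and f: "f \<in> Lp p M" and g: "g \<in> Lp p M"
  shows "integrable M (\<lambda>x. powr_gap p (f x) (g x))"
    and "(\<integral>x. powr_gap p (f x) (g x) \<partial>M) =
      (Lp_energy p M f + Lp_energy p M g) / 2 - Lp_energy p M (\<lambda>x. (f x + g x) / 2)"
  using Lp_integrable_powr[OF Lp_midpoint[OF p f g]] Lp_integrable_powr[OF f] Lp_integrable_powr[OF g]
  unfolding powr_gap_def Lp_energy_def by simp_all

lemma (in finite_measure) L1_dist_small_if_powr_gap_small:
  assumes p: "p > 1" and e: "e > 0" and E: "E \<ge> 0"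
  obtains d where "d > 0"
    "\<And>f g. f \<in> Lp p M \<Longrightarrow> g \<in> Lp p M \<Longrightarrow> Lp_energy p M f \<le> E \<Longrightarrow> Lp_energy p M g \<le> E \<Longrightarrow>
      (\<integral>x. powr_gap p (f x) (g x) \<partial>M) < d \<Longrightarrow> (\<integral>x. \<bar>f x - g x\<bar> \<partial>M) < e"
proof -
  define \<mu> \<epsilon> where "\<mu> = measure M (space M)" and "\<epsilon> = e / 2 / (\<mu> + 2 * E + 1)"
  have den: "\<mu> + 2 * E + 1 > 0"
    using E by (simp add: \<mu>_def add_nonneg_pos)
  then have \<epsilon>: "\<epsilon> > 0" "\<epsilon> * (\<mu> + E + E) < e / 2"
    using e by (simp_all add: \<epsilon>_def field_simps)
  obtain C where C: "C \<ge> 0"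
    "\<And>a b. \<bar>a - b\<bar> \<le> \<epsilon> * (1 + \<bar>a\<bar> powr p + \<bar>b\<bar> powr p) + C * powr_gap p a b"
    using abs_diff_le_powr_gap[OF p \<epsilon>(1)] by blast
  show thesis
  proof (rule that[of "e / 2 / (C + 1)"])
    show "e / 2 / (C + 1) > 0"
      using e C(1) by simp
    fix f g
    assume f: "f \<in> Lp p M" "Lp_energy p M f \<le> E" and g: "g \<in> Lp p M" "Lp_energy p M g \<le> E"
      and gap: "(\<integral>x. powr_gap p (f x) (g x) \<partial>M) < e / 2 / (C + 1)"
    note int = integral_powr_gap(1)[OF p f(1) g(1)]
      Lp_integrable_powr[OF f(1)] Lp_integrable_powr[OF g(1)]
    have "(\<integral>x. \<bar>f x - g x\<bar> \<partial>M) \<le>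
        (\<integral>x. \<epsilon> * (1 + \<bar>f x\<bar> powr p + \<bar>g x\<bar> powr p) + C * powr_gap p (f x) (g x) \<partial>M)"
      using C(2) int Lp_integrable[OF _ f(1)] Lp_integrable[OF _ g(1)] p by (intro integral_mono) auto
    also have "\<dots> = \<epsilon> * (\<mu> + Lp_energy p M f + Lp_energy p M g) + C * (\<integral>x. powr_gap p (f x) (g x) \<partial>M)"
      using int by (simp add: Lp_energy_def \<mu>_def)
    also have "\<dots> \<le> \<epsilon> * (\<mu> + E + E) + C * (e / 2 / (C + 1))"
      using \<epsilon>(1) C(1) f(2) g(2) gap by (intro add_mono mult_left_mono) auto
    also have "\<dots> < e / 2 + e / 2"
      using \<epsilon>(2) C(1) e by (intro add_less_le_mono) (auto simp: field_simps)
    finally show "(\<integral>x. \<bar>f x - g x\<bar> \<partial>M) < e"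
      by simp
  qed
qed

lemma decseq_near_infima:
  fixes J :: "'a \<Rightarrow> real" and K :: "nat \<Rightarrow> 'a set"
  assumes "decseq K" and J_nonneg: "\<And>f. J f \<ge> 0" and near: "\<And>m e. e > 0 \<Longrightarrow> \<exists>f\<in>K m. J f < L + e"
  obtains f l I where "\<And>m. f m \<in> K m" "\<And>m. J (f m) < l + inverse (real (Suc m))"
    "\<And>m g. g \<in> K m \<Longrightarrow> I m \<le> J g" "I \<longlonglongrightarrow> l" "l \<le> L"
proof -
  define I where "I m = Inf (J ` K m)" for m
  have bdd: "bdd_below (J ` K m)" for m
    by (rule bdd_belowI[of _ 0]) (auto simp: J_nonneg)
  have nonempty: "K m \<noteq> {}" for m
    using near[of 1 m] by auto
  have I_le: "I m \<le> J g" if "g \<in> K m" for g m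
    unfolding I_def using that bdd by (intro cInf_lower) auto
  have "I m \<le> L" for m
  proof (rule field_le_epsilon)
    fix e :: real assume "e > 0"
    then show "I m \<le> L + e"
      using near[of e m] I_le[of _ m] by (auto intro: order_trans less_imp_le)
  qed
  moreover have "incseq I"
    unfolding incseq_def I_def using \<open>decseq K\<close> nonempty bdd
    by (auto simp: decseq_def intro!: cInf_superset_mono)
  ultimately obtain l where l: "I \<longlonglongrightarrow> l" "\<And>m. I m \<le> l" "l \<le> L"
    using incseq_convergent[of I L] LIMSEQ_le_const2[of I _ L] by metis
  have "\<exists>f\<in>K m. J f < l + inverse (real (Suc m))" for m
  proof -
    have "I m < l + inverse (real (Suc m))"
      by (rule le_less_trans[OF l(2)]) simp
    then show ?thesis
      using cInf_lessD[of "J ` K m"] nonempty[of m] by (auto simp: I_def)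
  qed
  then obtain f where "\<And>m. f m \<in> K m" "\<And>m. J (f m) < l + inverse (real (Suc m))"
    by metis
  with that I_le l show thesis
    by blast
qed

lemma integral_powr_gap_le:
  assumes p: "p > 1" and f: "f \<in> Lp p M" "Lp_energy p M f \<le> E" and g: "g \<in> Lp p M" "Lp_energy p M g \<le> E"
    and mid: "I \<le> Lp_energy p M (\<lambda>x. (f x + g x) / 2)"
  shows "(\<integral>x. powr_gap p (f x) (g x) \<partial>M) \<le> E - I"
proof -
  define h where "h = (\<lambda>x. (f x + g x) / 2)"
  have "(\<integral>x. powr_gap p (f x) (g x) \<partial>M) = (Lp_energy p M f + Lp_energy p M g) / 2 - Lp_energy p M h"
    using integral_powr_gap(2)[OF p f(1) g(1)] by (simp add: h_def)
  moreover have "I \<le> Lp_energy p M h"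
    using mid by (simp add: h_def)
  ultimately show ?thesis
    using f(2) g(2) by (simp add: field_simps)
qed

text \<open>Midpoints of near-minimisers stay in the convex sets, so they have almost the same energy and
  strict convexity makes the near-minimisers Cauchy; this replaces weak compactness of \<open>L\<^sup>p\<close>.\<close>

lemma decseq_midpoint_convex_near_minimizers:
  fixes K :: "nat \<Rightarrow> ('a \<Rightarrow> real) set"
  assumes p: "p > 1" and K: "decseq K" "\<And>m. K m \<subseteq> Lp p M"
    and mid: "\<And>m f g. f \<in> K m \<Longrightarrow> g \<in> K m \<Longrightarrow> (\<lambda>x. (f x + g x) / 2) \<in> K m"
    and near: "\<And>m e. e > 0 \<Longrightarrow> \<exists>f\<in>K m. Lp_energy p M f < L + e"
  obtains f l where "\<And>m. f m \<in> K m" "\<And>m. Lp_energy p M (f m) \<le> l + inverse (real (Suc m))" "l \<le> L"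
    "\<And>d. d > 0 \<Longrightarrow> \<exists>N. \<forall>i\<ge>N. \<forall>j\<ge>N. (\<integral>x. powr_gap p (f i x) (f j x) \<partial>M) < d"
proof -
  obtain f l I where f: "\<And>m. f m \<in> K m" "\<And>m. Lp_energy p M (f m) < l + inverse (real (Suc m))"
    and I: "\<And>m g. g \<in> K m \<Longrightarrow> I m \<le> Lp_energy p M g" "I \<longlonglongrightarrow> l" and "l \<le> L"
    using decseq_near_infima[where J = "Lp_energy p M", OF K(1) Lp_energy_nonneg near] by metis
  have "\<exists>N. \<forall>i\<ge>N. \<forall>j\<ge>N. (\<integral>x. powr_gap p (f i x) (f j x) \<partial>M) < d" if "d > 0" for d
  proof -
    have "(\<lambda>m. l + inverse (real (Suc m)) - I m) \<longlonglongrightarrow> l - l"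
      using LIMSEQ_inverse_real_of_nat_add I(2) by (intro tendsto_diff)
    then have "\<forall>\<^sub>F m in sequentially. l + inverse (real (Suc m)) - I m < d"
      using \<open>d > 0\<close> by (intro order_tendstoD(2)) auto
    then obtain N where N: "l + inverse (real (Suc N)) - I N < d"
      by (auto simp: eventually_sequentially)
    have tail: "f i \<in> K N" "Lp_energy p M (f i) \<le> l + inverse (real (Suc N))" if "i \<ge> N" for i
    proof -
      show "f i \<in> K N"
        using f(1) K(1) that by (auto simp: decseq_def)
      have "inverse (real (Suc i)) \<le> inverse (real (Suc N))"
        using that by (intro le_imp_inverse_le) auto
      then show "Lp_energy p M (f i) \<le> l + inverse (real (Suc N))"
        using f(2)[of i] by linarith
    qed
    have "(\<integral>x. powr_gap p (f i x) (f j x) \<partial>M) < d" if "i \<ge> N" "j \<ge> N" for i j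
      using integral_powr_gap_le[OF p _ tail(2)[OF that(1)] _ tail(2)[OF that(2)] I(1)[OF mid]]
        tail(1)[OF that(1)] tail(1)[OF that(2)] K(2) N by (meson le_less_trans subsetD)
    then show ?thesis
      by blast
  qed
  with that f less_imp_le[OF f(2)] \<open>l \<le> L\<close> show thesis
    by blast
qed

lemma (in finite_measure) decseq_midpoint_convex_L1_limit:
  fixes K :: "nat \<Rightarrow> ('a \<Rightarrow> real) set"
  assumes p: "p > 1" and K: "decseq K" "\<And>m. K m \<subseteq> Lp p M"
    and mid: "\<And>m f g. f \<in> K m \<Longrightarrow> g \<in> K m \<Longrightarrow> (\<lambda>x. (f x + g x) / 2) \<in> K m"
    and near: "\<And>m e. e > 0 \<Longrightarrow> \<exists>f\<in>K m. Lp_energy p M f < L + e"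
  obtains f g where "\<And>m. f m \<in> K m" "g \<in> Lp p M" "Lp_energy p M g \<le> L"
    "(\<lambda>m. \<integral>x. \<bar>f m x - g x\<bar> \<partial>M) \<longlonglongrightarrow> 0"
proof -
  obtain f l where f: "\<And>m. f m \<in> K m"
    and energy: "\<And>m. Lp_energy p M (f m) \<le> l + inverse (real (Suc m))" and "l \<le> L"
    and gap: "\<And>d. d > 0 \<Longrightarrow> \<exists>N. \<forall>i\<ge>N. \<forall>j\<ge>N. (\<integral>x. powr_gap p (f i x) (f j x) \<partial>M) < d"
    using decseq_midpoint_convex_near_minimizers[OF p K mid near] by blast
  have f_Lp: "f m \<in> Lp p M" for m
    using f K(2) by auto
  have bound: "Lp_energy p M (f m) \<le> l + 1" for m
    by (rule order_trans[OF energy]) (simp add: inverse_le_1_iff)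
  have Cauchy: "\<exists>N. \<forall>i\<ge>N. \<forall>j\<ge>N. (\<integral>x. \<bar>f i x - f j x\<bar> \<partial>M) < e" if e: "e > 0" for e
  proof -
    obtain d where d: "d > 0" "\<And>f g. f \<in> Lp p M \<Longrightarrow> g \<in> Lp p M \<Longrightarrow>
        Lp_energy p M f \<le> l + 1 \<Longrightarrow> Lp_energy p M g \<le> l + 1 \<Longrightarrow>
        (\<integral>x. powr_gap p (f x) (g x) \<partial>M) < d \<Longrightarrow> (\<integral>x. \<bar>f x - g x\<bar> \<partial>M) < e"
      using L1_dist_small_if_powr_gap_small[OF p e order_trans[OF Lp_energy_nonneg bound]] by blast
    then show ?thesis
      using gap[OF d(1)] d(2)[OF f_Lp f_Lp bound bound] by blast
  qed
  obtain g r where g: "g \<in> borel_measurable M" "strict_mono r" "AE x in M. (\<lambda>i. f (r i) x) \<longlonglongrightarrow> g x"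
    and L1: "(\<lambda>n. \<integral>x. \<bar>f n x - g x\<bar> \<partial>M) \<longlonglongrightarrow> 0"
    using L1_Cauchy_AE_convergent_subseq[OF Lp_integrable[OF less_imp_le[OF p] f_Lp] Cauchy] by blast
  have "(\<lambda>i. l + inverse (real (Suc (r i)))) \<longlonglongrightarrow> l"
    using LIMSEQ_subseq_LIMSEQ[OF LIMSEQ_inverse_real_of_nat_add g(2)] by (simp add: o_def)
  with p have "g \<in> Lp p M" "Lp_energy p M g \<le> l"
    using Lp_Fatou[OF _ f_Lp g(1,3) energy] by auto
  with that f L1 \<open>l \<le> L\<close> show thesis
    by fastforce
qed

section \<open>Functions with a \<open>p\<close>-integrable derivative\<close>

lemma finite_measure_lebesgue_on_Icc: "finite_measure (lebesgue_on {a..b::real})"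
  by (simp add: finite_measure_lebesgue_on)

lemma Lp_subinterval:
  fixes w :: "real \<Rightarrow> real"
  assumes w: "w \<in> Lp p (lebesgue_on {a..b})" and sub: "{c..d} \<subseteq> {a..b}"
  shows "w \<in> Lp p (lebesgue_on {c..d})"
    and "Lp_energy p (lebesgue_on {c..d}) w \<le> Lp_energy p (lebesgue_on {a..b}) w"
proof -
  show "w \<in> Lp p (lebesgue_on {c..d})"
    using measurable_restrict_mono[OF Lp_measurable[OF w] sub]
      integrable_subinterval[OF Lp_integrable_powr[OF w] sub] by (simp add: Lp_def)
  show "Lp_energy p (lebesgue_on {c..d}) w \<le> Lp_energy p (lebesgue_on {a..b}) w"
    unfolding Lp_energy_def using Lp_integrable_powr[OF w] sub
    by (intro integral_mono_lebesgue_on_AE) auto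
qed

lemma Lp_integrable_on:
  fixes w :: "real \<Rightarrow> real"
  assumes p: "p \<ge> 1" and w: "w \<in> Lp p (lebesgue_on {a..b})" and sub: "{c..d} \<subseteq> {a..b}"
  shows "w integrable_on {c..d}" and "(\<lambda>x. \<bar>w x\<bar>) integrable_on {c..d}"
  using finite_measure.Lp_integrable[OF finite_measure_lebesgue_on_Icc p Lp_subinterval(1)[OF w sub]]
  by (auto intro!: integrable_on_lebesgue_on)

lemma Lp_mult_continuous_on:
  fixes h w :: "real \<Rightarrow> real"
  assumes "p \<ge> 0" and w: "w \<in> Lp p (lebesgue_on {a..b})" and h: "continuous_on {a..b} h"
  shows "(\<lambda>x. h x * w x) \<in> Lp p (lebesgue_on {a..b})"
proof -
  have "bounded (h ` {a..b})"
    using h by (intro compact_imp_bounded compact_continuous_image) auto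
  then obtain C where "\<And>x. x \<in> {a..b} \<Longrightarrow> \<bar>h x\<bar> \<le> C"
    unfolding bounded_iff real_norm_def by blast
  then show ?thesis
    using assms by (intro Lp_mult_bounded continuous_imp_measurable_on_sets_lebesgue) auto
qed

text \<open>The function \<open>v\<close> is the continuous representative of a member of the Sobolev space
  \<open>W\<^bsup>1,p\<^esup>(a, b)\<close> with weak derivative \<open>w\<close>.\<close>

definition has_Lp_derivative ::
    "real \<Rightarrow> real \<Rightarrow> real \<Rightarrow> (real \<Rightarrow> real) \<Rightarrow> (real \<Rightarrow> real) \<Rightarrow> bool" where
  "has_Lp_derivative p a b v w \<longleftrightarrow>
    w \<in> Lp p (lebesgue_on {a..b}) \<and> (\<forall>x\<in>{a..b}. v x = v a + integral {a..x} w)"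

lemma has_Lp_derivative_Lp: "has_Lp_derivative p a b v w \<Longrightarrow> w \<in> Lp p (lebesgue_on {a..b})"
  by (simp add: has_Lp_derivative_def)

lemma has_Lp_derivative_eq:
  "has_Lp_derivative p a b v w \<Longrightarrow> x \<in> {a..b} \<Longrightarrow> v x = v a + integral {a..x} w"
  unfolding has_Lp_derivative_def by blast

lemma has_Lp_derivative_has_integral:
  assumes p: "p \<ge> 1" and v: "has_Lp_derivative p a b v w" and st: "a \<le> s" "s \<le> t" "t \<le> b"
  shows "(w has_integral v t - v s) {s..t}"
proof -
  note int = Lp_integrable_on(1)[OF p has_Lp_derivative_Lp[OF v]]
  have "v t - v s = integral {a..t} w - integral {a..s} w"
    using has_Lp_derivative_eq[OF v, of s] has_Lp_derivative_eq[OF v, of t] st by simp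
  also have "\<dots> = integral {s..t} w"
    using Henstock_Kurzweil_Integration.integral_combine[OF st(1,2), of w] int[of a t] st by simp
  finally show ?thesis
    using int[of s t] st by (simp add: has_integral_integrable_integral)
qed

lemma has_Lp_derivative_continuous_on:
  assumes p: "p \<ge> 1" and v: "has_Lp_derivative p a b v w"
  shows "continuous_on {a..b} v"
proof (rule continuous_on_eq)
  show "continuous_on {a..b} (\<lambda>x. v a + integral {a..x} w)"
    using Lp_integrable_on(1)[OF p has_Lp_derivative_Lp[OF v] order_refl]
    by (intro continuous_intros indefinite_integral_continuous_1)
qed (rule has_Lp_derivative_eq[OF v, symmetric])

lemma has_Lp_derivative_Hoelder:
  assumes p: "p > 1" and v: "has_Lp_derivative p a b v w" and "s \<in> {a..b}" "t \<in> {a..b}"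
  shows "\<bar>v t - v s\<bar> \<le> \<bar>t - s\<bar> powr (1 - 1 / p) * Lp_energy p (lebesgue_on {a..b}) w powr (1 / p)"
  using assms(3,4)
proof (induction s t rule: linorder_wlog)
  case (le s t)
  define M where "M = lebesgue_on {s..t}"
  interpret M: finite_measure M
    unfolding M_def by (rule finite_measure_lebesgue_on_Icc)
  have sub: "{s..t} \<subseteq> {a..b}"
    using le by auto
  have w: "w \<in> Lp p M" "Lp_energy p M w \<le> Lp_energy p (lebesgue_on {a..b}) w"
    unfolding M_def using Lp_subinterval[OF has_Lp_derivative_Lp[OF v] sub] by auto
  have "v t - v s = (\<integral>x. w x \<partial>M)"
    using has_Lp_derivative_has_integral[OF _ v, of s t] M.Lp_integrable[OF _ w(1)] p le
    by (simp add: M_def lebesgue_integral_eq_integral integral_unique)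
  then have "\<bar>v t - v s\<bar> \<le> (\<integral>x. \<bar>w x\<bar> \<partial>M)"
    by simp
  also have "\<dots> \<le> (t - s) powr (1 - 1 / p) * Lp_energy p M w powr (1 / p)"
    using M.integral_abs_le_Lp_energy[OF p w(1)] le(1) by (simp add: M_def measure_restrict_space)
  also have "\<dots> \<le> (t - s) powr (1 - 1 / p) * Lp_energy p (lebesgue_on {a..b}) w powr (1 / p)"
    using w(2) p by (intro mult_left_mono powr_mono2) (auto simp: Lp_energy_nonneg)
  finally show ?case
    using le(1) by simp
qed (simp add: abs_minus_commute)

lemma mean_value_composition:
  fixes \<phi> \<phi>' v :: "real \<Rightarrow> real"
  assumes \<phi>: "\<And>y. y \<in> v ` {s..t} \<Longrightarrow> (\<phi> has_real_derivative \<phi>' y) (at y)"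
    and v: "continuous_on {s..t} v" and "s \<le> t"
  obtains r where "r \<in> {s..t}" "\<phi> (v t) - \<phi> (v s) = \<phi>' (v r) * (v t - v s)"
proof -
  have mvt: "\<exists>r\<in>{s..t}. \<phi> (v y) - \<phi> (v x) = \<phi>' (v r) * (v y - v x)"
    if "x \<in> {s..t}" "y \<in> {s..t}" "v x < v y" for x y
  proof -
    have image: "{v x..v y} \<subseteq> v ` {s..t}"
      using that v by (intro connected_contains_Icc connected_continuous_image) auto
    then have "\<exists>z>v x. z < v y \<and> \<phi> (v y) - \<phi> (v x) = (v y - v x) * \<phi>' z"
      using that(3) \<phi> by (intro MVT2) auto
    then obtain z where z: "v x < z" "z < v y" "\<phi> (v y) - \<phi> (v x) = \<phi>' z * (v y - v x)"
      by (auto simp: mult.commute)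
    then have "z \<in> v ` {s..t}"
      using image by auto
    with z(3) show ?thesis
      by blast
  qed
  consider (eq) "v s = v t" | (less) "v s < v t" | (greater) "v t < v s"
    by linarith
  then show thesis
  proof cases
    case eq
    then show thesis
      using that[of s] \<open>s \<le> t\<close> by simp
  next
    case less
    then show thesis
      using mvt[of s t] that \<open>s \<le> t\<close> by auto
  next
    case greater
    then obtain r where "r \<in> {s..t}" "\<phi> (v s) - \<phi> (v t) = \<phi>' (v r) * (v s - v t)"
      using mvt[of t s] \<open>s \<le> t\<close> by auto
    then show thesis
      by (intro that[of r]) (auto simp: algebra_simps)
  qed
qed

lemma has_Lp_derivative_mult_compose_Lp:
  assumes p: "p \<ge> 1" and v: "has_Lp_derivative p a b v w" and h: "continuous_on (v ` {a..b}) h"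
  shows "(\<lambda>x. h (v x) * w x) \<in> Lp p (lebesgue_on {a..b})"
proof (rule Lp_mult_continuous_on[OF _ has_Lp_derivative_Lp[OF v]])
  show "continuous_on {a..b} (\<lambda>x. h (v x))"
    using continuous_on_compose2[OF h has_Lp_derivative_continuous_on[OF p v]] by auto
qed (use p in simp)

lemma chain_rule_defect_le:
  fixes \<phi> \<phi>' :: "real \<Rightarrow> real"
  assumes p: "p \<ge> 1" and v: "has_Lp_derivative p a b v w" and st: "a \<le> s" "s \<le> t" "t \<le> b"
    and \<phi>: "\<And>y. y \<in> v ` {a..b} \<Longrightarrow> (\<phi> has_real_derivative \<phi>' y) (at y)"
    and \<phi>': "continuous_on (v ` {a..b}) \<phi>'"
    and osc: "\<And>x y. x \<in> {s..t} \<Longrightarrow> y \<in> {s..t} \<Longrightarrow> \<bar>\<phi>' (v x) - \<phi>' (v y)\<bar> \<le> e"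
  shows "\<bar>\<phi> (v t) - \<phi> (v s) - integral {s..t} (\<lambda>x. \<phi>' (v x) * w x)\<bar> \<le> e * integral {s..t} (\<lambda>x. \<bar>w x\<bar>)"
proof -
  have sub: "{s..t} \<subseteq> {a..b}"
    using st by auto
  have "(\<phi> has_real_derivative \<phi>' y) (at y)" if "y \<in> v ` {s..t}" for y
    using that \<phi> sub by auto
  moreover have "continuous_on {s..t} v"
    using has_Lp_derivative_continuous_on[OF p v] sub by (rule continuous_on_subset)
  ultimately obtain r where r: "r \<in> {s..t}" "\<phi> (v t) - \<phi> (v s) = \<phi>' (v r) * (v t - v s)"
    using mean_value_composition st(2) by blast
  have "(\<lambda>x. \<phi>' (v x) * w x) integrable_on {s..t}"
    using Lp_integrable_on(1)[OF p has_Lp_derivative_mult_compose_Lp[OF p v \<phi>'] sub] .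
  then have "((\<lambda>x. \<phi>' (v r) * w x - \<phi>' (v x) * w x) has_integral
      \<phi>' (v r) * (v t - v s) - integral {s..t} (\<lambda>x. \<phi>' (v x) * w x)) {s..t}"
    using has_Lp_derivative_has_integral[OF p v st]
    by (intro has_integral_diff has_integral_mult_right integrable_integral)
  moreover have "((\<lambda>x. e * \<bar>w x\<bar>) has_integral e * integral {s..t} (\<lambda>x. \<bar>w x\<bar>)) {s..t}"
    using Lp_integrable_on(2)[OF p has_Lp_derivative_Lp[OF v] sub]
    by (intro has_integral_mult_right integrable_integral)
  moreover have "norm (\<phi>' (v r) * w x - \<phi>' (v x) * w x) \<le> e * \<bar>w x\<bar>" if "x \<in> {s..t}" for x
    using osc[OF r(1) that] by (auto simp: left_diff_distrib[symmetric] abs_mult intro: mult_right_mono)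
  ultimately have "norm (\<phi>' (v r) * (v t - v s) - integral {s..t} (\<lambda>x. \<phi>' (v x) * w x)) \<le>
      e * integral {s..t} (\<lambda>x. \<bar>w x\<bar>)"
    by (metis (no_types, lifting) integral_norm_bound_integral has_integral_integrable integral_unique)
  then show ?thesis
    by (simp add: r(2))
qed

lemma eq_if_increments_locally_small:
  fixes F N :: "real \<Rightarrow> real"
  assumes "a \<le> b"
    and local: "\<And>e x. e > 0 \<Longrightarrow> x \<in> {a..b} \<Longrightarrow>
      \<exists>d>0. \<forall>s t. a \<le> s \<and> s \<le> x \<and> x \<le> t \<and> t \<le> b \<and> t - s < d \<longrightarrow> \<bar>F t - F s\<bar> \<le> e * (N t - N s)"
  shows "F b = F a"
proof -
  have bound: "\<bar>F b - F a\<bar> \<le> e * (N b - N a)" if e: "e > 0" for e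
  proof -
    define P where "P s t \<longleftrightarrow> a \<le> s \<and> t \<le> b \<longrightarrow> \<bar>F t - F s\<bar> \<le> e * (N t - N s)" for s t
    have "P a b"
      using \<open>a \<le> b\<close>
    proof (induction rule: Bolzano)
      case (trans r s t)
      then show ?case
        by (auto simp: P_def algebra_simps)
    next
      case (local x)
      then obtain d where "d > 0" "\<forall>s t. a \<le> s \<and> s \<le> x \<and> x \<le> t \<and> t \<le> b \<and> t - s < d \<longrightarrow>
          \<bar>F t - F s\<bar> \<le> e * (N t - N s)"
        using assms(2)[OF e, of x] by auto
      then show ?case
        unfolding P_def by blast
    qed
    then show ?thesis
      by (simp add: P_def)
  qed
  have "\<bar>F b - F a\<bar> \<le> 0 + e" if e: "e > 0" for e
  proof -
    have "\<bar>F b - F a\<bar> \<le> e / (\<bar>N b - N a\<bar> + 1) * (N b - N a)"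
      using e by (intro bound) auto
    also have "\<dots> \<le> e / (\<bar>N b - N a\<bar> + 1) * (\<bar>N b - N a\<bar> + 1)"
      using e by (intro mult_left_mono) auto
    finally show ?thesis
      by simp
  qed
  then show ?thesis
    using field_le_epsilon[of "\<bar>F b - F a\<bar>" 0] by simp
qed

lemma chain_rule_defect_locally_small:
  fixes \<phi> \<phi>' :: "real \<Rightarrow> real"
  assumes p: "p \<ge> 1" and v: "has_Lp_derivative p a b v w"
    and \<phi>: "\<And>y. y \<in> v ` {a..b} \<Longrightarrow> (\<phi> has_real_derivative \<phi>' y) (at y)"
    and \<phi>': "continuous_on (v ` {a..b}) \<phi>'" and "e > 0"
  obtains d where "d > 0" "\<And>s t. a \<le> s \<Longrightarrow> s \<le> t \<Longrightarrow> t \<le> b \<Longrightarrow> t - s < d \<Longrightarrow>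
    \<bar>\<phi> (v t) - \<phi> (v s) - integral {s..t} (\<lambda>x. \<phi>' (v x) * w x)\<bar> \<le> e * integral {s..t} (\<lambda>x. \<bar>w x\<bar>)"
proof -
  have "continuous_on {a..b} (\<lambda>x. \<phi>' (v x))"
    using continuous_on_compose2[OF \<phi>' has_Lp_derivative_continuous_on[OF p v]] by auto
  then have "uniformly_continuous_on {a..b} (\<lambda>x. \<phi>' (v x))"
    by (intro compact_uniformly_continuous) auto
  then obtain d where d: "d > 0" "\<And>s t. s \<in> {a..b} \<Longrightarrow> t \<in> {a..b} \<Longrightarrow> \<bar>s - t\<bar> < d \<Longrightarrow>
      \<bar>\<phi>' (v s) - \<phi>' (v t)\<bar> < e"
    using \<open>e > 0\<close> unfolding uniformly_continuous_on_def dist_real_def by metis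
  show thesis
  proof (rule that[OF d(1)])
    fix s t assume "a \<le> s" "s \<le> t" "t \<le> b" "t - s < d"
    then show "\<bar>\<phi> (v t) - \<phi> (v s) - integral {s..t} (\<lambda>x. \<phi>' (v x) * w x)\<bar> \<le>
        e * integral {s..t} (\<lambda>x. \<bar>w x\<bar>)"
      by (intro chain_rule_defect_le[OF p v _ _ _ \<phi> \<phi>']) (auto intro!: less_imp_le[OF d(2)])
  qed
qed

lemma has_Lp_derivative_compose:
  fixes \<phi> \<phi>' :: "real \<Rightarrow> real"
  assumes p: "p \<ge> 1" and v: "has_Lp_derivative p a b v w"
    and \<phi>: "\<And>y. y \<in> v ` {a..b} \<Longrightarrow> (\<phi> has_real_derivative \<phi>' y) (at y)"
    and \<phi>': "continuous_on (v ` {a..b}) \<phi>'"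
  shows "has_Lp_derivative p a b (\<lambda>x. \<phi> (v x)) (\<lambda>x. \<phi>' (v x) * w x)"
  unfolding has_Lp_derivative_def
proof (intro conjI ballI)
  define f where "f = (\<lambda>x. \<phi>' (v x) * w x)"
  show f: "(\<lambda>x. \<phi>' (v x) * w x) \<in> Lp p (lebesgue_on {a..b})"
    by (rule has_Lp_derivative_mult_compose_Lp[OF p v \<phi>'])
  fix x assume x: "x \<in> {a..b}"
  define F N where "F t = \<phi> (v t) - integral {a..t} f" and "N t = integral {a..t} (\<lambda>x. \<bar>w x\<bar>)" for t
  have increments: "N t - N s = integral {s..t} (\<lambda>x. \<bar>w x\<bar>)"
      "F t - F s = \<phi> (v t) - \<phi> (v s) - integral {s..t} f" if "a \<le> s" "s \<le> t" "t \<le> b" for s t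
    using Henstock_Kurzweil_Integration.integral_combine[OF that(1,2), of "\<lambda>x. \<bar>w x\<bar>"]
      Henstock_Kurzweil_Integration.integral_combine[OF that(1,2), of f]
      Lp_integrable_on(2)[OF p has_Lp_derivative_Lp[OF v], of a t]
      Lp_integrable_on(1)[OF p f, of a t] that(3)
    by (auto simp: N_def F_def f_def)
  have "F x = F a"
  proof (rule eq_if_increments_locally_small[where F = F and N = N])
    fix e y :: real assume e: "e > 0" and "y \<in> {a..x}"
    obtain d where d: "d > 0" "\<And>s t. a \<le> s \<Longrightarrow> s \<le> t \<Longrightarrow> t \<le> b \<Longrightarrow> t - s < d \<Longrightarrow>
        \<bar>\<phi> (v t) - \<phi> (v s) - integral {s..t} f\<bar> \<le> e * integral {s..t} (\<lambda>x. \<bar>w x\<bar>)"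
      using chain_rule_defect_locally_small[OF p v \<phi> \<phi>' e, folded f_def] by blast
    then show "\<exists>d>0. \<forall>s t. a \<le> s \<and> s \<le> y \<and> y \<le> t \<and> t \<le> x \<and> t - s < d \<longrightarrow>
        \<bar>F t - F s\<bar> \<le> e * (N t - N s)"
      using x by (intro exI[of _ d]) (auto simp: increments)
  qed (use x in auto)
  then show "\<phi> (v x) = \<phi> (v a) + integral {a..x} (\<lambda>x. \<phi>' (v x) * w x)"
    by (simp add: F_def f_def)
qed

lemma indefinite_integral_has_right_derivative_ae:
  fixes f :: "real \<Rightarrow> real"
  assumes f: "f integrable_on {a..b}"
  obtains N where "negligible N" "\<And>x. x \<in> {a..<b} - N \<Longrightarrow>
    ((\<lambda>h. (integral {a..x + h} f - integral {a..x} f) / h) \<longlongrightarrow> f x) (at_right 0)"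
proof -
  define g where "g x = (if x \<in> {a..b} then f x else 0)" for x
  have "g integrable_on UNIV"
    unfolding g_def using f by (simp only: integrable_restrict_UNIV)
  then have "g integrable_on cbox c d" for c d
    by (rule integrable_on_subcbox) simp
  then obtain N where N: "negligible N" "\<And>x e. x \<notin> N \<Longrightarrow> 0 < e \<Longrightarrow>
      \<exists>d>0. \<forall>h. 0 < h \<and> h < d \<longrightarrow> norm (integral {x..x + h} g /\<^sub>R h - g x) < e"
    using integrable_ccontinuous_explicit[of g] by (auto simp: cbox_interval)
  have "((\<lambda>h. (integral {a..x + h} f - integral {a..x} f) / h) \<longlongrightarrow> f x) (at_right 0)"
    if x: "x \<in> {a..<b} - N" for x
  proof (rule Lim_transform_eventually)
    show "((\<lambda>h. integral {x..x + h} g / h) \<longlongrightarrow> f x) (at_right 0)"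
      using N(2)[of x] x unfolding tendsto_iff eventually_at_right_field dist_real_def
      by (simp add: g_def divide_inverse mult.commute imp_conjL)
    have "integral {x..x + h} g = integral {a..x + h} f - integral {a..x} f"
      if "0 < h" "h < b - x" for h
    proof -
      have "integral {x..x + h} g = integral {x..x + h} f"
        using x that by (intro integral_cong) (auto simp: g_def)
      then show ?thesis
        using Henstock_Kurzweil_Integration.integral_combine[of a x "x + h" f]
          integrable_on_subinterval[OF f, of a "x + h"] x that by simp
    qed
    then show "\<forall>\<^sub>F h in at_right 0.
        integral {x..x + h} g / h = (integral {a..x + h} f - integral {a..x} f) / h"
      using x by (auto simp: eventually_at_right_field intro!: exI[of _ "b - x"])
  qed
  with N(1) that show thesis
    by blast
qed

lemma indefinite_integral_has_left_derivative_ae: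
  fixes f :: "real \<Rightarrow> real"
  assumes f: "f integrable_on {a..b}"
  obtains N where "negligible N" "\<And>x. x \<in> {a<..b} - N \<Longrightarrow>
    ((\<lambda>h. (integral {a..x - h} f - integral {a..x} f) / - h) \<longlongrightarrow> f x) (at_right 0)"
proof -
  define F where "F x = integral {- b..x} (\<lambda>x. f (- x))" for x
  obtain N where N: "negligible N"
    "\<And>x. x \<in> {- b..<- a} - N \<Longrightarrow> ((\<lambda>h. (F (x + h) - F x) / h) \<longlongrightarrow> f (- x)) (at_right 0)"
    using indefinite_integral_has_right_derivative_ae[of "\<lambda>x. f (- x)" "- b" "- a"] f
    unfolding F_def by auto
  have F: "F (- x) = integral {a..b} f - integral {a..x} f" if "x \<in> {a..b}" for x
    using Henstock_Kurzweil_Integration.integral_combine[of a x b f] f that by (simp add: F_def)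
  show thesis
  proof (rule that)
    show "negligible (uminus ` N)"
      using N(1) by (intro negligible_differentiable_image_negligible) (auto intro!: derivative_intros)
    fix x assume x: "x \<in> {a<..b} - uminus ` N"
    show "((\<lambda>h. (integral {a..x - h} f - integral {a..x} f) / - h) \<longlongrightarrow> f x) (at_right 0)"
    proof (rule Lim_transform_eventually)
      have "- x \<notin> N"
        using x imageI[of "- x" N uminus] by auto
      then show "((\<lambda>h. (F (- x + h) - F (- x)) / h) \<longlongrightarrow> f x) (at_right 0)"
        using N(2)[of "- x"] x by auto
      have "(F (- x + h) - F (- x)) / h = (integral {a..x - h} f - integral {a..x} f) / - h"
        if "0 < h" "h < x - a" for h
      proof -
        have "F (- x + h) - F (- x) = - (integral {a..x - h} f - integral {a..x} f)"
          using F[of "x - h"] F[of x] x that by simp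
        then show ?thesis
          by (simp only: minus_divide_left[symmetric] minus_divide_right[symmetric])
      qed
      then show "\<forall>\<^sub>F h in at_right 0.
          (F (- x + h) - F (- x)) / h = (integral {a..x - h} f - integral {a..x} f) / - h"
        using x by (auto simp: eventually_at_right_field intro!: exI[of _ "x - a"])
    qed
  qed
qed

lemma indefinite_integral_has_derivative_ae:
  fixes f :: "real \<Rightarrow> real"
  assumes f: "f integrable_on {a..b}"
  obtains N where "negligible N"
    "\<And>x. x \<in> {a..b} - N \<Longrightarrow> ((\<lambda>x. integral {a..x} f) has_real_derivative f x) (at x)"
proof -
  obtain R where R: "negligible R" "\<And>x. x \<in> {a..<b} - R \<Longrightarrow>
      ((\<lambda>h. (integral {a..x + h} f - integral {a..x} f) / h) \<longlongrightarrow> f x) (at_right 0)"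
    using indefinite_integral_has_right_derivative_ae[OF f] by blast
  obtain L where L: "negligible L" "\<And>x. x \<in> {a<..b} - L \<Longrightarrow>
      ((\<lambda>h. (integral {a..x - h} f - integral {a..x} f) / - h) \<longlongrightarrow> f x) (at_right 0)"
    using indefinite_integral_has_left_derivative_ae[OF f] by blast
  have "negligible ({a, b} \<union> R \<union> L)"
    using R(1) L(1) by (intro negligible_Un) auto
  moreover have "((\<lambda>x. integral {a..x} f) has_real_derivative f x) (at x)"
    if "x \<in> {a..b} - ({a, b} \<union> R \<union> L)" for x
    unfolding DERIV_def
  proof (rule filterlim_split_at)
    show "((\<lambda>h. (integral {a..x + h} f - integral {a..x} f) / h) \<longlongrightarrow> f x) (at_right 0)"
      using that by (intro R(2)) auto
    show "((\<lambda>h. (integral {a..x + h} f - integral {a..x} f) / h) \<longlongrightarrow> f x) (at_left 0)"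
      using L(2)[of x] that by (simp add: filterlim_at_left_to_right)
  qed
  ultimately show thesis
    using that by blast
qed

lemma tendsto_indefinite_integral_if_L1:
  fixes f :: "nat \<Rightarrow> real \<Rightarrow> real"
  assumes f: "\<And>n. integrable (lebesgue_on {a..b}) (f n)" and g: "integrable (lebesgue_on {a..b}) g"
    and lim: "(\<lambda>n. \<integral>x. \<bar>f n x - g x\<bar> \<partial>lebesgue_on {a..b}) \<longlonglongrightarrow> 0" and x: "x \<in> {a..b}"
  shows "(\<lambda>n. integral {a..x} (f n)) \<longlonglongrightarrow> integral {a..x} g"
proof (rule LIM_zero_cancel, rule Lim_null_comparison[OF always_eventually lim], rule allI)
  fix n
  have sub: "{a..x} \<subseteq> {a..b}"
    using x by auto
  note int = integrable_subinterval[OF f sub] integrable_subinterval[OF g sub]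
  have "integral {a..x} (f n) - integral {a..x} g = (\<integral>t. f n t - g t \<partial>lebesgue_on {a..x})"
    using int(1)[of n] int(2) by (simp add: lebesgue_integral_eq_integral)
  then have "norm (integral {a..x} (f n) - integral {a..x} g) \<le>
      (\<integral>t. \<bar>f n t - g t\<bar> \<partial>lebesgue_on {a..x})"
    by simp
  also have "\<dots> \<le> (\<integral>t. \<bar>f n t - g t\<bar> \<partial>lebesgue_on {a..b})"
    using f[of n] g sub by (intro integral_mono_lebesgue_on_AE) auto
  finally show "norm (integral {a..x} (f n) - integral {a..x} g) \<le>
      (\<integral>t. \<bar>f n t - g t\<bar> \<partial>lebesgue_on {a..b})" .
qed

definition Lp_primitive_near ::
    "real \<Rightarrow> real \<Rightarrow> real \<Rightarrow> (real \<Rightarrow> real) \<Rightarrow> real \<Rightarrow> (real \<Rightarrow> real) set" where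
  "Lp_primitive_near p a b D e =
    {f \<in> Lp p (lebesgue_on {a..b}). \<forall>x\<in>{a..b}. \<bar>integral {a..x} f - D x\<bar> \<le> e}"

lemma Lp_primitive_near_mono: "e \<le> e' \<Longrightarrow> Lp_primitive_near p a b D e \<subseteq> Lp_primitive_near p a b D e'"
  unfolding Lp_primitive_near_def by (auto intro: order_trans)

lemma Lp_primitive_near_midpoint:
  assumes p: "p > 1" and f: "f \<in> Lp_primitive_near p a b D e" and g: "g \<in> Lp_primitive_near p a b D e"
  shows "(\<lambda>x. (f x + g x) / 2) \<in> Lp_primitive_near p a b D e"
  unfolding Lp_primitive_near_def
proof (intro CollectI conjI ballI)
  have Lp: "f \<in> Lp p (lebesgue_on {a..b})" "g \<in> Lp p (lebesgue_on {a..b})"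
    using f g by (simp_all add: Lp_primitive_near_def)
  then show "(\<lambda>x. (f x + g x) / 2) \<in> Lp p (lebesgue_on {a..b})"
    by (rule Lp_midpoint[OF p])
  fix x assume x: "x \<in> {a..b}"
  then have "integral {a..x} (\<lambda>x. (f x + g x) / 2) = (integral {a..x} f + integral {a..x} g) / 2"
    using Lp_integrable_on(1)[OF less_imp_le[OF p] Lp(1), of a x]
      Lp_integrable_on(1)[OF less_imp_le[OF p] Lp(2), of a x]
    by (simp add: Henstock_Kurzweil_Integration.integral_add)
  moreover have "\<bar>integral {a..x} f - D x\<bar> \<le> e" "\<bar>integral {a..x} g - D x\<bar> \<le> e"
    using f g x by (auto simp: Lp_primitive_near_def)
  ultimately show "\<bar>integral {a..x} (\<lambda>x. (f x + g x) / 2) - D x\<bar> \<le> e"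
    by (simp add: abs_le_iff field_simps)
qed

lemma has_Lp_derivative_Lp_primitive_near:
  assumes v: "has_Lp_derivative p a b v w" and near: "\<And>x. x \<in> {a..b} \<Longrightarrow> \<bar>v x - V x\<bar> \<le> e / 2"
  shows "w \<in> Lp_primitive_near p a b (\<lambda>x. V x - V a) e"
  unfolding Lp_primitive_near_def
proof (intro CollectI conjI ballI has_Lp_derivative_Lp[OF v])
  fix x assume x: "x \<in> {a..b}"
  then have "integral {a..x} w = v x - v a"
    using has_Lp_derivative_eq[OF v x] by simp
  then show "\<bar>integral {a..x} w - (V x - V a)\<bar> \<le> e"
    using near[of x] near[of a] x unfolding abs_le_iff by simp
qed

lemma Lp_primitive_near_L1_limit:
  assumes p: "p > 1" and f: "\<And>m. f m \<in> Lp_primitive_near p a b D (inverse (real (Suc m)))"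
    and g: "g \<in> Lp p (lebesgue_on {a..b})" and x: "x \<in> {a..b}"
    and L1: "(\<lambda>m. \<integral>x. \<bar>f m x - g x\<bar> \<partial>lebesgue_on {a..b}) \<longlonglongrightarrow> 0"
  shows "integral {a..x} g = D x"
proof (rule LIMSEQ_unique)
  have "f m \<in> Lp p (lebesgue_on {a..b})" for m
    using f[of m] by (simp add: Lp_primitive_near_def)
  then show "(\<lambda>m. integral {a..x} (f m)) \<longlonglongrightarrow> integral {a..x} g"
    using g p by (intro tendsto_indefinite_integral_if_L1[OF _ _ L1 x]
        finite_measure.Lp_integrable[OF finite_measure_lebesgue_on_Icc, of p]) auto
  show "(\<lambda>m. integral {a..x} (f m)) \<longlonglongrightarrow> D x"
  proof (rule LIM_zero_cancel, rule Lim_null_comparison)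
    show "\<forall>\<^sub>F m in sequentially. norm (integral {a..x} (f m) - D x) \<le> inverse (real (Suc m))"
      using f x by (simp add: Lp_primitive_near_def)
  qed (rule LIMSEQ_inverse_real_of_nat)
qed

lemma has_Lp_derivative_uniform_limit:
  assumes p: "p > 1" and v: "\<And>n. has_Lp_derivative p a b (v n) (w n)"
    and E: "\<And>n. Lp_energy p (lebesgue_on {a..b}) (w n) \<le> E n" "E \<longlonglongrightarrow> L"
    and lim: "uniform_limit {a..b} v V sequentially"
  obtains W where "has_Lp_derivative p a b V W" "Lp_energy p (lebesgue_on {a..b}) W \<le> L"
proof -
  interpret finite_measure "lebesgue_on {a..b}"
    by (rule finite_measure_lebesgue_on_Icc)
  define K where "K m = Lp_primitive_near p a b (\<lambda>x. V x - V a) (inverse (real (Suc m)))" for m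
  have K_Lp: "K m \<subseteq> Lp p (lebesgue_on {a..b})" for m
    by (auto simp: K_def Lp_primitive_near_def)
  have K_decseq: "decseq K"
    unfolding decseq_def K_def by (intro allI impI Lp_primitive_near_mono le_imp_inverse_le) auto
  have near: "\<exists>f\<in>K m. Lp_energy p (lebesgue_on {a..b}) f < L + e" if "e > 0" for m e
  proof -
    have "\<forall>\<^sub>F n in sequentially. E n < L + e"
      using E(2) that by (intro order_tendstoD(2)) auto
    moreover have "\<forall>\<^sub>F n in sequentially. \<forall>x\<in>{a..b}. dist (v n x) (V x) < inverse (real (Suc m)) / 2"
      using lim by (rule uniform_limitD) simp
    ultimately have "\<forall>\<^sub>F n in sequentially. w n \<in> K m \<and> Lp_energy p (lebesgue_on {a..b}) (w n) < L + e"
    proof eventually_elim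
      case (elim n)
      then show ?case
        unfolding K_def using E(1)[of n]
        by (intro conjI has_Lp_derivative_Lp_primitive_near[OF v]) (auto simp: dist_real_def intro: less_imp_le)
    qed
    then show ?thesis
      using eventually_happens'[OF sequentially_bot] by blast
  qed
  have mid: "(\<lambda>x. (f x + g x) / 2) \<in> K m" if "f \<in> K m" "g \<in> K m" for f g m
    using that unfolding K_def by (rule Lp_primitive_near_midpoint[OF p])
  obtain f W where f: "\<And>m. f m \<in> K m"
    and W: "W \<in> Lp p (lebesgue_on {a..b})" "Lp_energy p (lebesgue_on {a..b}) W \<le> L"
    and L1: "(\<lambda>m. \<integral>x. \<bar>f m x - W x\<bar> \<partial>lebesgue_on {a..b}) \<longlonglongrightarrow> 0"
    using decseq_midpoint_convex_L1_limit[OF p K_decseq K_Lp mid near] by blast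
  have "integral {a..x} W = V x - V a" if "x \<in> {a..b}" for x
    using Lp_primitive_near_L1_limit[OF p f[unfolded K_def] W(1) that L1] .
  then have "has_Lp_derivative p a b V W"
    using W(1) by (simp add: has_Lp_derivative_def)
  with W(2) that show thesis
    by blast
qed

lemma has_Lp_derivative_equicontinuous:
  assumes p: "p > 1" and e: "e > 0"
  obtains d where "d > 0" "\<And>v w x y. has_Lp_derivative p a b v w \<Longrightarrow>
    Lp_energy p (lebesgue_on {a..b}) w \<le> C \<Longrightarrow> x \<in> {a..b} \<Longrightarrow> y \<in> {a..b} \<Longrightarrow> \<bar>x - y\<bar> < d \<Longrightarrow>
    \<bar>v x - v y\<bar> < e"
proof -
  have "((\<lambda>h. h powr (1 - 1 / p) * C powr (1 / p)) \<longlongrightarrow> 0 powr (1 - 1 / p) * C powr (1 / p)) (at_right 0)"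
    using p by (intro tendsto_intros tendsto_powr') (auto simp: eventually_at_filter)
  then have "((\<lambda>h. h powr (1 - 1 / p) * C powr (1 / p)) \<longlongrightarrow> 0) (at_right 0)"
    by simp
  from order_tendstoD(2)[OF this e] obtain d where d: "d > 0"
    "\<And>h. 0 < h \<Longrightarrow> h < d \<Longrightarrow> h powr (1 - 1 / p) * C powr (1 / p) < e"
    by (auto simp: eventually_at_right_field)
  have "\<bar>v x - v y\<bar> < e"
    if v: "has_Lp_derivative p a b v w" "Lp_energy p (lebesgue_on {a..b}) w \<le> C"
      and xy: "x \<in> {a..b}" "y \<in> {a..b}" "\<bar>x - y\<bar> < d" for v w x y
  proof (cases "x = y")
    case False
    have "\<bar>v x - v y\<bar> \<le> \<bar>x - y\<bar> powr (1 - 1 / p) * Lp_energy p (lebesgue_on {a..b}) w powr (1 / p)"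
      using has_Lp_derivative_Hoelder[OF p v(1) xy(2,1)] .
    also have "\<dots> \<le> \<bar>x - y\<bar> powr (1 - 1 / p) * C powr (1 / p)"
      using p v(2) by (intro mult_left_mono powr_mono2) (auto simp: Lp_energy_nonneg)
    also have "\<dots> < e"
      using d(2) xy(3) False by simp
    finally show ?thesis .
  qed (use e in simp)
  with d(1) that show thesis
    by blast
qed

lemma has_Lp_derivative_compact:
  assumes p: "p > 1" and v: "\<And>n. has_Lp_derivative p a b (v n) (w n)"
    and E: "\<And>n. Lp_energy p (lebesgue_on {a..b}) (w n) \<le> E n" "E \<longlonglongrightarrow> L"
    and B: "\<And>n x. x \<in> {a..b} \<Longrightarrow> \<bar>v n x\<bar> \<le> B"
  obtains r V W where "strict_mono (r :: nat \<Rightarrow> nat)"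
    "uniform_limit {a..b} (\<lambda>n. v (r n)) V sequentially"
    "has_Lp_derivative p a b V W" "Lp_energy p (lebesgue_on {a..b}) W \<le> L"
proof -
  obtain C where "\<And>n. E n \<le> C"
    using convergent_imp_Bseq[OF convergentI[OF E(2)]] unfolding Bseq_def by (auto dest: abs_le_D1)
  then have C: "Lp_energy p (lebesgue_on {a..b}) (w n) \<le> C" for n
    using E(1) order_trans by blast
  have equi: "\<exists>d>0. \<forall>n y. y \<in> {a..b} \<and> norm (x - y) < d \<longrightarrow> norm (v n x - v n y) < e"
    if "x \<in> {a..b}" "e > 0" for x e
    using has_Lp_derivative_equicontinuous[OF p \<open>e > 0\<close>, of a b C] v C that(1)
    unfolding real_norm_def by metis
  obtain V r where r: "strict_mono (r :: nat \<Rightarrow> nat)"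
    and V: "\<And>e. 0 < e \<Longrightarrow> \<exists>N. \<forall>n x. n \<ge> N \<and> x \<in> {a..b} \<longrightarrow> norm (v (r n) x - V x) < e"
    using Arzela_Ascoli[of "{a..b}" v B] B equi unfolding real_norm_def by (metis compact_Icc)
  then have lim: "uniform_limit {a..b} (\<lambda>n. v (r n)) V sequentially"
    unfolding uniform_limit_iff eventually_sequentially dist_norm by blast
  have "(\<lambda>n. E (r n)) \<longlonglongrightarrow> L"
    using LIMSEQ_subseq_LIMSEQ[OF E(2) r] by (simp add: o_def)
  from has_Lp_derivative_uniform_limit[OF p v E(1) this lim] that[OF r lim] show thesis
    by blast
qed

section \<open>The bending primitive\<close>

definition bend_weight :: "real \<Rightarrow> real \<Rightarrow> real" where
  "bend_weight p s = 1 / (1 + s\<^sup>2) powr (3/2 - 1 / (2 * p))"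

definition bend_primitive :: "real \<Rightarrow> real \<Rightarrow> real" where
  "bend_primitive p s = (LBINT t=0..s. bend_weight p t)"

lemma bend_weight_pos: "bend_weight p s > 0"
  using sum_power2_gt_zero_iff[of 1 s] by (simp add: bend_weight_def)

lemma continuous_on_bend_weight: "continuous_on A (bend_weight p)"
proof -
  have "1 + s\<^sup>2 \<noteq> 0" for s :: real
    using sum_power2_gt_zero_iff[of 1 s] by simp
  then show ?thesis
    unfolding bend_weight_def by (intro continuous_intros) (auto simp: powr_eq_0_iff)
qed

lemma set_integrable_bend_weight:
  assumes "p \<ge> 1"
  shows "set_integrable lborel {0..} (bend_weight p)"
proof (rule set_integrable_bound)
  show "set_integrable lborel {0..} (\<lambda>s::real. inverse (1 + s\<^sup>2))"
    using integrable_inverse_1_plus_square by (rule set_integrable_subset) auto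
  show "set_borel_measurable lborel {0..} (bend_weight p)"
    unfolding set_borel_measurable_def
    using borel_measurable_continuous_onI[OF continuous_on_bend_weight] by measurable
  have "1 \<le> 3/2 - 1 / (2 * p)"
    using assms by (simp add: field_simps)
  then have "(1 + s\<^sup>2) powr 1 \<le> (1 + s\<^sup>2) powr (3/2 - 1 / (2 * p))" for s :: real
    by (intro powr_mono) auto
  then have "bend_weight p s \<le> inverse (1 + s\<^sup>2)" for s
    using sum_power2_gt_zero_iff[of 1 s]
    by (auto simp: bend_weight_def inverse_eq_divide intro!: divide_left_mono mult_pos_pos)
  then show "AE s in lborel. s \<in> {0..} \<longrightarrow> norm (bend_weight p s) \<le> norm (inverse (1 + s\<^sup>2))"
    using bend_weight_pos[of p] by (intro AE_I2) (auto simp: abs_of_pos)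
qed

lemma bend_primitive_has_derivative:
  "(bend_primitive p has_real_derivative bend_weight p s) (at s)"
proof -
  define a b where "a = min 0 s - 1" and "b = max 0 s + 1"
  have "((\<lambda>u. LBINT t=0..u. bend_weight p t) has_vector_derivative bend_weight p s)
      (at s within {a..b})"
    unfolding zero_ereal_def
    using continuous_on_bend_weight by (intro interval_integral_FTC2) (auto simp: a_def b_def)
  then show ?thesis
    by (simp add: has_real_derivative_iff_has_vector_derivative bend_primitive_def[abs_def]
        at_within_Icc_at a_def b_def)
qed

lemma continuous_on_bend_primitive: "continuous_on A (bend_primitive p)"
  using bend_primitive_has_derivative
  by (intro continuous_at_imp_continuous_on ballI DERIV_isCont) blast

lemma bend_primitive_minus: "bend_primitive p (- s) = - bend_primitive p s"
proof -
  have "bend_primitive p (- s) = (LBINT t=s..0. bend_weight p t)"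
    unfolding bend_primitive_def
    by (subst interval_integral_reflect) (simp add: bend_weight_def[abs_def])
  then show ?thesis
    by (simp add: bend_primitive_def interval_integral_endpoints_reverse[of s])
qed

lemma strict_mono_bend_primitive: "strict_mono (bend_primitive p)"
proof (rule strict_monoI)
  show "bend_primitive p s < bend_primitive p t" if "s < t" for s t
    using that
    by (rule DERIV_pos_imp_increasing) (use bend_primitive_has_derivative bend_weight_pos in blast)
qed

lemma bend_primitive_tendsto_at_top:
  assumes "p \<ge> 1"
  shows "(bend_primitive p \<longlongrightarrow> cp p / 2) at_top"
proof (rule Lim_transform_eventually)
  show "((\<lambda>b. LINT t:{0..b}|lborel. bend_weight p t) \<longlongrightarrow> cp p / 2) at_top"
    using tendsto_set_lebesgue_integral_at_top[OF _ set_integrable_bend_weight[OF assms]]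
    by (simp add: cp_def bend_weight_def[abs_def])
  show "\<forall>\<^sub>F b in at_top. (LINT t:{0..b}|lborel. bend_weight p t) = bend_primitive p b"
    using eventually_ge_at_top[of 0]
    by eventually_elim (simp add: bend_primitive_def zero_ereal_def interval_integral_Icc)
qed

lemma range_bend_primitive:
  assumes p: "p \<ge> 1"
  shows "range (bend_primitive p) = {- cp p / 2<..<cp p / 2}"
proof -
  have less: "bend_primitive p s < cp p / 2" for s
  proof -
    have "bend_primitive p (s + 1) \<le> cp p / 2"
      using bend_primitive_tendsto_at_top[OF p] strict_mono_mono[OF strict_mono_bend_primitive]
      by (intro tendsto_lowerbound) (auto simp: mono_def intro!: eventually_mono[OF eventually_ge_at_top])
    then show ?thesis
      using strict_monoD[OF strict_mono_bend_primitive, of s "s + 1" p] by simp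
  qed
  have above: "\<exists>s. y < bend_primitive p s" if "y < cp p / 2" for y
    using order_tendstoD(1)[OF bend_primitive_tendsto_at_top[OF p] that]
    by (auto simp: eventually_at_top_linorder)
  have "y \<in> range (bend_primitive p)" if y: "y \<in> {- cp p / 2<..<cp p / 2}" for y
  proof -
    obtain s t where "y < bend_primitive p t" "- y < bend_primitive p s"
      using above[of y] above[of "- y"] y by auto
    then have "y \<in> {bend_primitive p (- s)..bend_primitive p t}"
      by (simp add: bend_primitive_minus)
    also have "\<dots> \<subseteq> range (bend_primitive p)"
      using continuous_on_bend_primitive by (intro connected_contains_Icc connected_continuous_image) auto
    finally show ?thesis .
  qed
  moreover have "bend_primitive p s \<in> {- cp p / 2<..<cp p / 2}" for s
    using less[of s] less[of "- s"] by (simp add: bend_primitive_minus)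
  ultimately show ?thesis
    by blast
qed

lemma cp_pos:
  assumes "p \<ge> 1"
  shows "cp p > 0"
  using rangeI[of "bend_primitive p" 0] unfolding range_bend_primitive[OF assms] by simp

lemma inv_bend_primitive [simp]: "inv (bend_primitive p) (bend_primitive p s) = s"
  using strict_mono_imp_inj_on[OF strict_mono_bend_primitive] by (simp add: inv_f_f)

lemma inv_bend_primitive_has_derivative:
  assumes p: "p \<ge> 1" and y: "\<bar>y\<bar> < cp p / 2"
  shows "(inv (bend_primitive p) has_real_derivative
    inverse (bend_weight p (inv (bend_primitive p) y))) (at y)"
proof -
  have "y \<in> range (bend_primitive p)"
    using y unfolding range_bend_primitive[OF p] abs_less_iff by simp
  then obtain s where s: "y = bend_primitive p s"
    by blast
  have "(inv (bend_primitive p) has_real_derivative inverse (bend_weight p s)) (at (bend_primitive p s))"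
    using bend_weight_pos[of p s] continuous_on_bend_primitive
    by (intro has_field_derivative_inverse_strong[where S = UNIV] bend_primitive_has_derivative) auto
  then show ?thesis
    by (simp add: s)
qed

lemma continuous_on_inv_bend_primitive:
  assumes "p \<ge> 1" and "\<And>y. y \<in> A \<Longrightarrow> \<bar>y\<bar> < cp p / 2"
  shows "continuous_on A (inv (bend_primitive p))"
  using assms inv_bend_primitive_has_derivative
  by (intro continuous_at_imp_continuous_on ballI DERIV_isCont) blast

section \<open>The elastic energy of a graph\<close>

definition W2p_slope :: "real \<Rightarrow> (real \<Rightarrow> real) \<Rightarrow> (real \<Rightarrow> real) \<Rightarrow> (real \<Rightarrow> real) \<Rightarrow> bool" where
  "W2p_slope p u d w \<longleftrightarrow>
    (\<forall>x\<in>{0..1}. (u has_real_derivative d x) (at x within {0..1})) \<and> has_Lp_derivative p 0 1 d w"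

lemma W2p_iff_slope:
  assumes p: "p \<ge> 1"
  shows "W2p p u \<longleftrightarrow> (\<exists>d w. W2p_slope p u d w)"
proof
  have int_eq: "(LINT t:{0..x}|lebesgue. w t) = integral {0..x} w"
    if "set_integrable lebesgue {0..1} w" "x \<in> {0..1}" for x :: real and w :: "real \<Rightarrow> real"
    using that set_integrable_subset[OF that(1), of "{0..x}"]
    by (intro set_lebesgue_integral_eq_integral(2)) auto
  have restrict: "set_integrable lebesgue {0..1} f \<longleftrightarrow> integrable (lebesgue_on {0..1}) f"
    for f :: "real \<Rightarrow> real"
    by (simp add: set_integrable_def integrable_restrict_space)
  show "\<exists>d w. W2p_slope p u d w" if "W2p p u"
  proof -
    obtain a w where w: "set_integrable lebesgue {0..1} w"
        "set_integrable lebesgue {0..1} (\<lambda>x. \<bar>w x\<bar> powr p)"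
      and u: "\<And>x. x \<in> {0..1} \<Longrightarrow>
        (u has_real_derivative a + (LINT t:{0..x}|lebesgue. w t)) (at x within {0..1})"
      using \<open>W2p p u\<close> unfolding W2p_def by blast
    then have "W2p_slope p u (\<lambda>x. a + integral {0..x} w) w"
      by (auto simp: W2p_slope_def has_Lp_derivative_def Lp_def restrict int_eq[OF w(1)])
    then show ?thesis
      by blast
  qed
  show "W2p p u" if slope: "\<exists>d w. W2p_slope p u d w"
  proof -
    obtain d w where u: "\<And>x. x \<in> {0..1} \<Longrightarrow> (u has_real_derivative d x) (at x within {0..1})"
      and d: "has_Lp_derivative p 0 1 d w"
      using slope unfolding W2p_slope_def by blast
    have w: "set_integrable lebesgue {0..1} w" "set_integrable lebesgue {0..1} (\<lambda>x. \<bar>w x\<bar> powr p)"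
      using finite_measure.Lp_integrable[OF finite_measure_lebesgue_on_Icc p has_Lp_derivative_Lp[OF d]]
        Lp_integrable_powr[OF has_Lp_derivative_Lp[OF d]] by (simp_all add: restrict)
    have "d x = d 0 + (LINT t:{0..x}|lebesgue. w t)" if "x \<in> {0..1}" for x
      using has_Lp_derivative_eq[OF d that] int_eq[OF w(1) that] by simp
    with w u show ?thesis
      unfolding W2p_def by (metis (no_types, lifting))
  qed
qed

lemma curvature_integrand_eq:
  assumes "p \<noteq> 0"
  shows "\<bar>w / (1 + s\<^sup>2) powr (3/2)\<bar> powr p * sqrt (1 + s\<^sup>2) = \<bar>bend_weight p s * w\<bar> powr p"
proof -
  define q where "q = 1 + s\<^sup>2"
  have q: "q > 0"
    using sum_power2_gt_zero_iff[of 1 s] by (simp add: q_def)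
  have "(q powr (3/2)) powr p = q powr ((3/2 - 1 / (2 * p)) * p) * q powr (1/2)"
    using assms by (simp add: powr_powr powr_add[symmetric] field_simps)
  moreover have "sqrt q = q powr (1/2)"
    using q by (simp add: powr_half_sqrt)
  ultimately show ?thesis
    unfolding bend_weight_def q_def[symmetric] using q
    by (simp add: abs_mult powr_mult powr_divide powr_powr)
qed

lemma has_Lp_derivative_bend_primitive:
  assumes "p \<ge> 1" "has_Lp_derivative p a b d w"
  shows "has_Lp_derivative p a b (\<lambda>x. bend_primitive p (d x)) (\<lambda>x. bend_weight p (d x) * w x)"
  using assms by (intro has_Lp_derivative_compose bend_primitive_has_derivative continuous_on_bend_weight)

lemma curvature_integrand_ae_eq:
  assumes p: "p \<ge> 1" and u: "W2p_slope p u d w"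
  obtains N where "negligible N" "\<And>x. x \<in> {0..1} - N \<Longrightarrow>
    \<bar>curv u x\<bar> powr p * sqrt (1 + (deriv u x)\<^sup>2) = \<bar>bend_weight p (d x) * w x\<bar> powr p"
proof -
  have du: "\<And>x. x \<in> {0..1} \<Longrightarrow> (u has_real_derivative d x) (at x within {0..1})"
    and d: "has_Lp_derivative p 0 1 d w"
    using u by (auto simp: W2p_slope_def)
  obtain N where N: "negligible N"
    "\<And>x. x \<in> {0..1} - N \<Longrightarrow> ((\<lambda>x. integral {0..x} w) has_real_derivative w x) (at x)"
    using indefinite_integral_has_derivative_ae
      Lp_integrable_on(1)[OF p has_Lp_derivative_Lp[OF d] order_refl] by blast
  have deriv_u: "deriv u x = d x" if "x \<in> {0<..<1}" for x
    using du[of x] that by (intro DERIV_imp_deriv) (auto simp: at_within_Icc_at)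
  have "\<bar>curv u x\<bar> powr p * sqrt (1 + (deriv u x)\<^sup>2) = \<bar>bend_weight p (d x) * w x\<bar> powr p"
    if x: "x \<in> {0..1} - ({0, 1} \<union> N)" for x
  proof -
    have "((\<lambda>x. d 0 + integral {0..x} w) has_real_derivative w x) (at x)"
      using N(2)[of x] x by (auto intro!: derivative_eq_intros)
    then have "(deriv u has_real_derivative w x) (at x)"
    proof (rule has_field_derivative_transform_within_open[of _ _ _ "{0<..<1}"])
      show "d 0 + integral {0..y} w = deriv u y" if "y \<in> {0<..<1}" for y
        using has_Lp_derivative_eq[OF d, of y] deriv_u[OF that] that by simp
    qed (use x in auto)
    then have "deriv (deriv u) x = w x"
      by (rule DERIV_imp_deriv)
    then show ?thesis
      using curvature_integrand_eq[of p "w x" "d x"] deriv_u[of x] p x by (simp add: curv_def)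
  qed
  moreover have "negligible ({0, 1} \<union> N)"
    using N(1) by (intro negligible_Un) auto
  ultimately show thesis
    using that by blast
qed

lemma Ep_eq_Lp_energy:
  assumes p: "p \<ge> 1" and u: "W2p_slope p u d w"
  shows "Ep p u = Lp_energy p (lebesgue_on {0..1}) (\<lambda>x. bend_weight p (d x) * w x)"
proof -
  define e where "e = (\<lambda>x. \<bar>bend_weight p (d x) * w x\<bar> powr p)"
  obtain N where N: "negligible N"
    "\<And>x. x \<in> {0..1} - N \<Longrightarrow> \<bar>curv u x\<bar> powr p * sqrt (1 + (deriv u x)\<^sup>2) = e x"
    using curvature_integrand_ae_eq[OF p u] unfolding e_def by blast
  have d: "has_Lp_derivative p 0 1 d w"
    using u by (simp add: W2p_slope_def)
  have e: "integrable (lebesgue_on {0..1}) e"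
    unfolding e_def
    by (intro Lp_integrable_powr has_Lp_derivative_Lp[OF has_Lp_derivative_bend_primitive[OF p d]])
  then have "e absolutely_integrable_on {0..1}"
    by (simp add: set_integrable_def integrable_restrict_space)
  then have "(\<lambda>x. \<bar>curv u x\<bar> powr p * sqrt (1 + (deriv u x)\<^sup>2)) absolutely_integrable_on {0..1}"
    using N by (rule absolutely_integrable_spike)
  then have "Ep p u = integral {0..1} (\<lambda>x. \<bar>curv u x\<bar> powr p * sqrt (1 + (deriv u x)\<^sup>2))"
    unfolding Ep_def by (rule set_lebesgue_integral_eq_integral(2))
  also have "\<dots> = integral {0..1} e"
    using N(1) by (rule integral_spike) (use N(2) in simp)
  also have "\<dots> = (\<integral>x. e x \<partial>lebesgue_on {0..1})"
    using e by (simp add: lebesgue_integral_eq_integral)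
  finally show ?thesis
    by (simp add: Lp_energy_def e_def)
qed

lemma symmetric_imp_derivative_antisymmetric:
  fixes u d :: "real \<Rightarrow> real"
  assumes u: "\<And>x. x \<in> {a..b} \<Longrightarrow> (u has_real_derivative d x) (at x within {a..b})"
    and u_sym: "\<And>x. x \<in> {a..b} \<Longrightarrow> u (a + b - x) = u x" and "a < b" and x: "x \<in> {a..b}"
  shows "d (a + b - x) = - d x"
proof -
  have image: "(\<lambda>x. a + b - x) ` {a..b} = {a..b}"
    using image_diff_atLeastAtMost[of "a + b" a b] by simp
  have "(u has_real_derivative d (a + b - x)) (at (a + b - x) within (\<lambda>x. a + b - x) ` {a..b})"
    unfolding image using x by (intro u) auto
  moreover have "((\<lambda>x. a + b - x) has_real_derivative - 1) (at x within {a..b})"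
    by (auto intro!: derivative_eq_intros)
  ultimately have "((\<lambda>x. u (a + b - x)) has_real_derivative - d (a + b - x)) (at x within {a..b})"
    using DERIV_image_chain[of u "d (a + b - x)" "\<lambda>x. a + b - x" x "{a..b}" "- 1"] by (simp add: o_def)
  then have "(u has_real_derivative - d (a + b - x)) (at x within {a..b})"
    by (rule has_field_derivative_transform_within[of _ _ _ _ 1]) (use x u_sym in auto)
  then have "- d (a + b - x) = d x"
    using u[OF x] x \<open>a < b\<close> vector_derivative_unique_within_closed_interval[of a b x u]
    by (auto simp: has_real_derivative_iff_has_vector_derivative)
  then show ?thesis
    by simp
qed

lemma bend_primitive_slope_le_Ep:
  assumes p: "p > 1" and u: "W2p_slope p u d w"
    and u_sym: "\<And>x. x \<in> {0..1} \<Longrightarrow> u (1 - x) = u x" and x: "x \<in> {0..1}"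
  shows "\<bar>bend_primitive p (d x)\<bar> \<le> Ep p u powr (1 / p) / 2"
proof -
  define z where "z x = bend_primitive p (d x)" for x
  have du: "\<And>x. x \<in> {0..1} \<Longrightarrow> (u has_real_derivative d x) (at x within {0..1})"
    and d: "has_Lp_derivative p 0 1 d w"
    using u by (auto simp: W2p_slope_def)
  have "d (1 - x) = - d x"
    using symmetric_imp_derivative_antisymmetric[of 0 1 u d x] du u_sym x by simp
  then have "z (1 - x) = - z x"
    by (simp add: z_def bend_primitive_minus)
  then have "2 * \<bar>z x\<bar> = \<bar>z (1 - x) - z x\<bar>"
    by simp
  also have "\<dots> \<le> \<bar>1 - x - x\<bar> powr (1 - 1 / p) * Ep p u powr (1 / p)"
    using has_Lp_derivative_Hoelder[OF p has_Lp_derivative_bend_primitive[OF _ d], of x "1 - x"] p x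
    by (simp add: z_def Ep_eq_Lp_energy[OF _ u])
  also have "\<dots> \<le> 1 powr (1 - 1 / p) * Ep p u powr (1 / p)"
    using p x by (intro mult_right_mono powr_mono2) auto
  finally show ?thesis
    by (simp add: z_def)
qed

lemma W2p_Ep_of_bend_primitive:
  assumes p: "p \<ge> 1" and z: "has_Lp_derivative p 0 1 z f" and bound: "\<And>x. x \<in> {0..1} \<Longrightarrow> \<bar>z x\<bar> < cp p / 2"
    and u: "\<And>x. x \<in> {0..1} \<Longrightarrow> (u has_real_derivative inv (bend_primitive p) (z x)) (at x within {0..1})"
  shows "W2p p u" and "Ep p u = Lp_energy p (lebesgue_on {0..1}) f"
proof -
  define d where "d x = inv (bend_primitive p) (z x)" for x
  have "has_Lp_derivative p 0 1 d (\<lambda>x. inverse (bend_weight p (inv (bend_primitive p) (z x))) * f x)"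
    unfolding d_def
  proof (rule has_Lp_derivative_compose[OF p z])
    show "continuous_on (z ` {0..1}) (\<lambda>y. inverse (bend_weight p (inv (bend_primitive p) y)))"
      using bound bend_weight_pos[of p]
      by (intro continuous_intros continuous_on_compose2[OF continuous_on_bend_weight[of UNIV]]
          continuous_on_inv_bend_primitive[OF p]) (auto simp: less_imp_neq[symmetric])
  qed (use bound in \<open>auto intro: inv_bend_primitive_has_derivative[OF p]\<close>)
  then have slope: "W2p_slope p u d (\<lambda>x. inverse (bend_weight p (d x)) * f x)"
    using u by (simp add: W2p_slope_def d_def)
  then show "W2p p u"
    using W2p_iff_slope[OF p] by blast
  show "Ep p u = Lp_energy p (lebesgue_on {0..1}) f"
    using Ep_eq_Lp_energy[OF p slope] less_imp_neq[OF bend_weight_pos, symmetric]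
    by (simp add: mult.assoc[symmetric])
qed

lemma antiderivatives_converge:
  fixes u d :: "nat \<Rightarrow> real \<Rightarrow> real"
  assumes u: "\<And>n x. x \<in> {a..b} \<Longrightarrow> (u n has_real_derivative d n x) (at x within {a..b})"
    and d: "uniform_limit {a..b} d D sequentially"
    and x0: "x\<^sub>0 \<in> {a..b}" "(\<lambda>n. u n x\<^sub>0) \<longlonglongrightarrow> l"
  obtains U where "\<And>x. x \<in> {a..b} \<Longrightarrow> (\<lambda>n. u n x) \<longlonglongrightarrow> U x"
    "\<And>x. x \<in> {a..b} \<Longrightarrow> (U has_real_derivative D x) (at x within {a..b})"
proof -
  have "\<exists>U. \<forall>x\<in>{a..b}. (\<lambda>n. u n x) \<longlonglongrightarrow> U x \<and> (U has_derivative (*) (D x)) (at x within {a..b})"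
  proof (rule has_derivative_sequence)
    show "x\<^sub>0 \<in> {a..b}" "(\<lambda>n. u n x\<^sub>0) \<longlonglongrightarrow> l"
      by (rule x0)+
    show "(u n has_derivative (*) (d n x)) (at x within {a..b})" if "x \<in> {a..b}" for n x
      using u[OF that] by (simp add: has_field_derivative_def)
    show "\<forall>\<^sub>F n in sequentially. \<forall>x\<in>{a..b}. \<forall>h. norm (d n x * h - D x * h) \<le> e * norm h" if "e > 0" for e
      using uniform_limitD[OF d that]
      by eventually_elim
        (auto simp: dist_real_def left_diff_distrib[symmetric] abs_mult less_imp_le
          intro!: mult_right_mono)
  qed simp
  with that show thesis
    unfolding has_field_derivative_def by blast
qed

lemma W2p_limit_of_bend_primitive_limit:
  assumes p: "p \<ge> 1" and slope: "\<And>n. W2p_slope p (u n) (d n) (w n)" and zero: "\<And>n. u n 0 = 0"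
    and bound: "\<And>n x. x \<in> {0..1} \<Longrightarrow> \<bar>bend_primitive p (d n x)\<bar> \<le> B" "B < cp p / 2"
    and lim: "uniform_limit {0..1} (\<lambda>n x. bend_primitive p (d n x)) Z sequentially"
    and Z: "has_Lp_derivative p 0 1 Z f"
  obtains U where "\<And>x. x \<in> {0..1} \<Longrightarrow> (\<lambda>n. u n x) \<longlonglongrightarrow> U x"
    "W2p p U" "Ep p U = Lp_energy p (lebesgue_on {0..1}) f"
proof -
  have "\<bar>Z x\<bar> \<le> B" if "x \<in> {0..1}" for x
    using tendsto_uniform_limitI[OF lim that] bound(1)[OF that]
    by (intro tendsto_upperbound[OF tendsto_rabs]) auto
  then have Z_less: "\<bar>Z x\<bar> < cp p / 2" if "x \<in> {0..1}" for x
    using bound(2) that le_less_trans by blast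
  have "uniform_limit {0..1} (\<lambda>n x. inv (bend_primitive p) (bend_primitive p (d n x)))
      (\<lambda>x. inv (bend_primitive p) (Z x)) sequentially"
  proof (rule uniform_limit_compose_uniformly_continuous_on[OF lim])
    show "uniformly_continuous_on {- B..B} (inv (bend_primitive p))"
      using bound(2) by (intro compact_uniformly_continuous continuous_on_inv_bend_primitive[OF p]) auto
  qed (use bound(1) in \<open>auto simp: abs_le_iff minus_le_iff\<close>)
  then have slope_lim: "uniform_limit {0..1} d (\<lambda>x. inv (bend_primitive p) (Z x)) sequentially"
    by simp
  have "(u n has_real_derivative d n x) (at x within {0..1})" if "x \<in> {0..1}" for n x
    using slope that by (simp add: W2p_slope_def)
  from antiderivatives_converge[of 0 1 u d, OF this slope_lim, of 0 0] zero
  obtain U where U: "\<And>x. x \<in> {0..1} \<Longrightarrow> (\<lambda>n. u n x) \<longlonglongrightarrow> U x"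
    "\<And>x. x \<in> {0..1} \<Longrightarrow> (U has_real_derivative inv (bend_primitive p) (Z x)) (at x within {0..1})"
    by auto
  from W2p_Ep_of_bend_primitive[OF p Z Z_less U(2)] that[OF U(1)] show thesis
    by blast
qed

lemma Ep_nonneg: "Ep p u \<ge> 0"
  unfolding Ep_def set_lebesgue_integral_def by (intro Bochner_Integration.integral_nonneg) auto

lemma powr_inverse_less_cp:
  assumes "p \<ge> 1" "0 \<le> Q" "Q < cp p powr p"
  shows "Q powr (1 / p) < cp p"
proof -
  have "Q powr (1 / p) < (cp p powr p) powr (1 / p)"
    using assms by (intro powr_less_mono2) auto
  then show ?thesis
    using assms(1) cp_pos[OF assms(1)] by (simp add: powr_powr)
qed

lemma symmetric_W2p_Ep_compact:
  assumes p: "p > 1" and W2p: "\<And>n. W2p p (u n)" and u_sym: "\<And>n x. x \<in> {0..1} \<Longrightarrow> u n (1 - x) = u n x"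
    and zero: "\<And>n. u n 0 = 0" and Ep: "\<And>n. Ep p (u n) \<le> Q" "(\<lambda>n. Ep p (u n)) \<longlonglongrightarrow> L"
    and Q: "Q < cp p powr p"
  obtains r U where "strict_mono (r :: nat \<Rightarrow> nat)" "\<And>x. x \<in> {0..1} \<Longrightarrow> (\<lambda>n. u (r n) x) \<longlonglongrightarrow> U x"
    "W2p p U" "Ep p U \<le> L"
proof -
  have p1: "p \<ge> 1"
    using p by simp
  have "\<exists>d w. W2p_slope p (u n) d w" for n
    using W2p W2p_iff_slope[OF p1] by blast
  then obtain d w where slope: "\<And>n. W2p_slope p (u n) (d n) (w n)"
    by metis
  have z: "has_Lp_derivative p 0 1 (\<lambda>x. bend_primitive p (d n x))
      (\<lambda>x. bend_weight p (d n x) * w n x)" for n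
    using has_Lp_derivative_bend_primitive[OF p1] slope unfolding W2p_slope_def by blast
  have z_le: "\<bar>bend_primitive p (d n x)\<bar> \<le> Q powr (1 / p) / 2" if "x \<in> {0..1}" for n x
  proof -
    have "Ep p (u n) powr (1 / p) \<le> Q powr (1 / p)"
      using p Ep(1) by (intro powr_mono2) (auto simp: Ep_nonneg)
    then show ?thesis
      using bend_primitive_slope_le_Ep[OF p slope u_sym that, of n] by simp
  qed
  obtain r Z f where r: "strict_mono (r :: nat \<Rightarrow> nat)"
    and lim: "uniform_limit {0..1} (\<lambda>n x. bend_primitive p (d (r n) x)) Z sequentially"
    and Z: "has_Lp_derivative p 0 1 Z f" and f: "Lp_energy p (lebesgue_on {0..1}) f \<le> L"
    using has_Lp_derivative_compact[OF p z
        eq_refl[OF Ep_eq_Lp_energy[OF p1 slope, symmetric]] Ep(2) z_le] by blast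
  have "Q powr (1 / p) / 2 < cp p / 2"
    using powr_inverse_less_cp[OF p1 order_trans[OF Ep_nonneg Ep(1)] Q] by simp
  from W2p_limit_of_bend_primitive_limit[of p "\<lambda>n. u (r n)", OF p1 slope zero z_le this lim Z]
  obtain U where U: "\<And>x. x \<in> {0..1} \<Longrightarrow> (\<lambda>n. u (r n) x) \<longlonglongrightarrow> U x"
    "W2p p U" "Ep p U = Lp_energy p (lebesgue_on {0..1}) f"
    by blast
  show thesis
    using that[OF r U(1,2)] U(3) f by simp
qed

lemma minimizing_sequence_below:
  fixes J :: "'a \<Rightarrow> real"
  assumes bdd: "bdd_below (J ` A)" and v: "v \<in> A" "J v < Q"
  obtains u where "\<And>n. u n \<in> A" "\<And>n. J (u n) \<le> Q" "(\<lambda>n. J (u n)) \<longlonglongrightarrow> Inf (J ` A)"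
proof -
  define L where "L = Inf (J ` A)"
  have L_le: "L \<le> J v" if "v \<in> A" for v
    unfolding L_def using that bdd by (intro cInf_lower) auto
  define q where "q n = min Q (L + inverse (real (Suc n)))" for n
  have "\<exists>u\<in>A. J u < q n" for n
  proof -
    have "L < q n"
      using L_le[OF v(1)] v(2) by (simp add: q_def)
    then show ?thesis
      using v(1) cInf_lessD[of "J ` A" "q n"] by (auto simp: L_def)
  qed
  then obtain u where u: "\<And>n. u n \<in> A" "\<And>n. J (u n) < q n"
    by metis
  have "(\<lambda>n. J (u n)) \<longlonglongrightarrow> L"
  proof (rule tendsto_sandwich[where f = "\<lambda>_. L"])
    show "(\<lambda>n. L + inverse (real (Suc n))) \<longlonglongrightarrow> L"
      by (rule LIMSEQ_inverse_real_of_nat_add)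
    show "\<forall>\<^sub>F n in sequentially. L \<le> J (u n)"
        "\<forall>\<^sub>F n in sequentially. J (u n) \<le> L + inverse (real (Suc n))"
      using L_le[OF u(1)] u(2) by (auto simp: q_def less_imp_le)
  qed simp
  moreover have "J (u n) \<le> Q" for n
    using u(2)[of n] by (simp add: q_def)
  ultimately show thesis
    using that u(1) unfolding L_def by blast
qed

lemma Msym_iff:
  "v \<in> Msym p \<psi> \<longleftrightarrow> W2p p v \<and> v 0 = 0 \<and> v 1 = 0 \<and>
    (\<forall>x\<in>{0..1}. \<psi> x \<le> v x) \<and> (\<forall>x\<in>{0..1}. v (1 - x) = v x)"
  unfolding Msym_def Mset_def W2p_W1p0_def by (blast intro: sym)

lemma Msym_pointwise_limit:
  assumes v: "\<And>n. v n \<in> Msym p \<psi>" and lim: "\<And>x. x \<in> {0..1} \<Longrightarrow> (\<lambda>n. v n x) \<longlonglongrightarrow> V x" and "W2p p V"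
  shows "V \<in> Msym p \<psi>"
  unfolding Msym_iff
proof (intro conjI ballI)
  show "V 0 = 0" "V 1 = 0"
    using lim[of 0] lim[of 1] v by (auto simp: Msym_iff LIMSEQ_const_iff)
  fix x :: real assume x: "x \<in> {0..1}"
  show "\<psi> x \<le> V x"
    using v x by (intro LIMSEQ_le_const[OF lim[OF x]]) (auto simp: Msym_iff)
  show "V (1 - x) = V x"
    using LIMSEQ_unique[OF lim[OF x], of "V (1 - x)"] lim[of "1 - x"] v x by (simp add: Msym_iff)
qed fact

theorem theorem6p1:
  fixes p :: real and \<psi> :: "real \<Rightarrow> real"
  assumes "p > 1"
    and "continuous_on {0..1} \<psi>"
    and "\<psi> 0 < 0" and "\<psi> 1 < 0"
    and "\<exists>x0\<in>{0<..<1}. \<psi> x0 > 0"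
    and "(INF v\<in>Msym p \<psi>. ereal (Ep p v)) < ereal (cp p powr p)"
  shows "\<exists>u\<in>Msym p \<psi>. \<forall>v\<in>Msym p \<psi>. Ep p u \<le> Ep p v"
proof -
  obtain v where v: "v \<in> Msym p \<psi>" "Ep p v < cp p powr p"
    using assms(6) by (auto simp: INF_less_iff)
  then obtain Q where Q: "Ep p v < Q" "Q < cp p powr p"
    using dense by blast
  define L where "L = Inf (Ep p ` Msym p \<psi>)"
  have bdd: "bdd_below (Ep p ` Msym p \<psi>)"
    by (rule bdd_belowI[of _ 0]) (auto simp: Ep_nonneg)
  obtain u where u: "\<And>n. u n \<in> Msym p \<psi>" "\<And>n. Ep p (u n) \<le> Q" "(\<lambda>n. Ep p (u n)) \<longlonglongrightarrow> L"
    using minimizing_sequence_below[of "Ep p" "Msym p \<psi>" v Q, OF bdd v(1) Q(1)]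
    unfolding L_def by blast
  have u_Msym: "W2p p (u n)" "x \<in> {0..1} \<Longrightarrow> u n (1 - x) = u n x" "u n 0 = 0" for n x
    using u(1)[of n] unfolding Msym_iff by blast+
  obtain r U where "\<And>x. x \<in> {0..1} \<Longrightarrow> (\<lambda>n. u (r n) x) \<longlonglongrightarrow> U x" "W2p p U" "Ep p U \<le> L"
    using symmetric_W2p_Ep_compact[OF \<open>p > 1\<close> u_Msym u(2,3) Q(2)] by blast
  moreover have "L \<le> Ep p v" if "v \<in> Msym p \<psi>" for v
    unfolding L_def using that bdd by (intro cInf_lower) auto
  ultimately show ?thesis
    using Msym_pointwise_limit[of "\<lambda>n. u (r n)" p \<psi> U] u(1) by (meson order_trans)
qed

end
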